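(* Let $G$ be a compact Hausdorff topological group, $X$ a Hausdorff $G$-space, and $E\to B=E/G$ a numerable principal $G$-bundle. Then $$\mathbf{TC}(X_G)\le \mathbf{TC}_G(X)\,\mathbf{TC}(B),$$ where $X_G=E\times_G X$ is the associated fibre space with fibre $X$.
   Context: For a map $p\colon E\to B$, $\mathrm{secat}(p)$ is the least $k$ such that $B$ is covered by $k$ open sets $U_i$ each admitting $s\colon U_i\to E$ with $ps$ homotopic to the inclusion ($\infty$ if none). $\mathbf{TC}(Y)=\mathrm{secat}(\pi\colon Y^I\to Y\times Y)$ with $\pi(\gamma)=(\gamma(0),\gamma(1))$, $Y^I$ the path space with compact-open topology. $\mathbf{TC}_G(X)$ is the equivariant version: the least $k$ such that $X\times X$ (diagonal action) is covered by $k$ $G$-invariant open sets $U_i$ each admitting a $G$-map $s\colon U_i\to X^I$ (action $(g\gamma)(t)=g\gamma(t)$) with $\pi s$ $G$-homotopic to the inclusion, $G$-homotopies being equivariant homotopies with $G$ acting trivially on $I$ ($\infty$ if none). Conventions $\infty\cdot n$ as usual. *)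

theory Defs
  imports "HOL-Analysis.Analysis" "HOL-Algebra.Group"
begin

abbreviation unit_I :: "real topology" where
  "unit_I \<equiv> top_of_set {0..1}"

text \<open>Carrier of the free path space: continuous paths [0,1] to X, made extensional
  (undefined outside [0,1]) so that each path has a unique representative.\<close>
definition path_carrier :: "'a topology \<Rightarrow> (real \<Rightarrow> 'a) set" where
  "path_carrier X = {\<gamma>. continuous_map unit_I X \<gamma> \<and> \<gamma> \<in> extensional {0..1}}"

definition path_space :: "'a topology \<Rightarrow> (real \<Rightarrow> 'a) topology" where
  "path_space X = subtopology
     (topology_generated_by
        {{\<gamma> \<in> path_carrier X. \<gamma> ` K \<subseteq> U} | K U. compactin unit_I K \<and> openin X U})
     (path_carrier X)"

text \<open>Sectional category (non-reduced), with value \<infinity> if no finite cover exists.\<close>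
definition secat :: "'e topology \<Rightarrow> 'b topology \<Rightarrow> ('e \<Rightarrow> 'b) \<Rightarrow> enat" where
  "secat E B p = (INF k \<in> {k::nat. \<exists>Us::nat \<Rightarrow> 'b set.
       topspace B \<subseteq> (\<Union>i<k. Us i) \<and>
       (\<forall>i<k. openin B (Us i) \<and>
          (\<exists>s. continuous_map (subtopology B (Us i)) E s \<and>
               homotopic_with (\<lambda>_. True) (subtopology B (Us i)) B (p \<circ> s) id))}. enat k)"

definition TC :: "'a topology \<Rightarrow> enat" where
  "TC X = secat (path_space X) (prod_topology X X) (\<lambda>\<gamma>. (\<gamma> 0, \<gamma> 1))"

definition TC_G :: "('g, 'm) monoid_scheme \<Rightarrow> ('g \<Rightarrow> 'a \<Rightarrow> 'a) \<Rightarrow> 'a topology \<Rightarrow> enat" where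
  "TC_G G act X = (INF k \<in> {k::nat. \<exists>Us::nat \<Rightarrow> ('a \<times> 'a) set.
       topspace (prod_topology X X) \<subseteq> (\<Union>i<k. Us i) \<and>
       (\<forall>i<k. openin (prod_topology X X) (Us i) \<and>
          (\<forall>g\<in>carrier G. \<forall>(a,b)\<in>Us i. (act g a, act g b) \<in> Us i) \<and>
          (\<exists>s. continuous_map (subtopology (prod_topology X X) (Us i)) (path_space X) s \<and>
               (\<forall>g\<in>carrier G. \<forall>(a,b)\<in>Us i. \<forall>t\<in>{0..1}.
                    s (act g a, act g b) t = act g (s (a,b) t)) \<and>
               (\<exists>H. continuous_map (prod_topology unit_I (subtopology (prod_topology X X) (Us i)))
                        (prod_topology X X) H \<and>
                    (\<forall>u\<in>Us i. H (0, u) = (s u 0, s u 1)) \<and>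
                    (\<forall>u\<in>Us i. H (1, u) = u) \<and>
                    (\<forall>g\<in>carrier G. \<forall>t\<in>{0..1}. \<forall>(a,b)\<in>Us i.
                       H (t, (act g a, act g b)) = (act g (fst (H (t,(a,b)))), act g (snd (H (t,(a,b))))))))) }. enat k)"

definition topological_group :: "('g, 'm) monoid_scheme \<Rightarrow> 'g topology \<Rightarrow> bool" where
  "topological_group G TG \<longleftrightarrow> group G \<and> topspace TG = carrier G \<and>
     continuous_map (prod_topology TG TG) TG (\<lambda>(a,b). a \<otimes>\<^bsub>G\<^esub> b) \<and>
     continuous_map TG TG (\<lambda>a. inv\<^bsub>G\<^esub> a)"

definition left_G_space :: "('g, 'm) monoid_scheme \<Rightarrow> 'g topology \<Rightarrow> ('g \<Rightarrow> 'a \<Rightarrow> 'a) \<Rightarrow> 'a topology \<Rightarrow> bool" where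
  "left_G_space G TG act X \<longleftrightarrow>
     continuous_map (prod_topology TG X) X (\<lambda>(g,x). act g x) \<and>
     (\<forall>x\<in>topspace X. act \<one>\<^bsub>G\<^esub> x = x) \<and>
     (\<forall>g\<in>carrier G. \<forall>h\<in>carrier G. \<forall>x\<in>topspace X. act (g \<otimes>\<^bsub>G\<^esub> h) x = act g (act h x))"

definition right_G_space :: "('g, 'm) monoid_scheme \<Rightarrow> 'g topology \<Rightarrow> ('e \<Rightarrow> 'g \<Rightarrow> 'e) \<Rightarrow> 'e topology \<Rightarrow> bool" where
  "right_G_space G TG ract E \<longleftrightarrow>
     continuous_map (prod_topology E TG) E (\<lambda>(e,g). ract e g) \<and>
     (\<forall>e\<in>topspace E. ract e \<one>\<^bsub>G\<^esub> = e) \<and>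
     (\<forall>g\<in>carrier G. \<forall>h\<in>carrier G. \<forall>e\<in>topspace E. ract e (g \<otimes>\<^bsub>G\<^esub> h) = ract (ract e g) h)"

definition numerable_cover :: "'b topology \<Rightarrow> 'j set \<Rightarrow> ('j \<Rightarrow> 'b set) \<Rightarrow> bool" where
  "numerable_cover B J U \<longleftrightarrow>
     (\<forall>j\<in>J. openin B (U j)) \<and> topspace B \<subseteq> (\<Union>j\<in>J. U j) \<and>
     (\<exists>\<phi>::'j \<Rightarrow> 'b \<Rightarrow> real.
        (\<forall>j\<in>J. continuous_map B euclideanreal (\<phi> j) \<and>
               (\<forall>b\<in>topspace B. 0 \<le> \<phi> j b) \<and>
               {b \<in> topspace B. \<phi> j b > 0} \<subseteq> U j) \<and>
        (\<forall>b\<in>topspace B. \<exists>V. openin B V \<and> b \<in> V \<and>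
               finite {j\<in>J. \<exists>c\<in>V. \<phi> j c > 0}) \<and>
        (\<forall>b\<in>topspace B. (\<Sum>j\<in>{j\<in>J. \<phi> j b > 0}. \<phi> j b) = 1))"

definition numerable_principal_bundle ::
  "('g, 'm) monoid_scheme \<Rightarrow> 'g topology \<Rightarrow> ('e \<Rightarrow> 'g \<Rightarrow> 'e) \<Rightarrow> 'e topology \<Rightarrow> 'b topology \<Rightarrow> ('e \<Rightarrow> 'b) \<Rightarrow> bool" where
  "numerable_principal_bundle G TG ract E B p \<longleftrightarrow>
     right_G_space G TG ract E \<and>
     quotient_map E B p \<and>
     (\<forall>e\<in>topspace E. \<forall>e'\<in>topspace E. p e = p e' \<longleftrightarrow> (\<exists>g\<in>carrier G. e' = ract e g)) \<and>
     (\<exists>(J::'b set set) U. numerable_cover B J U \<and>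
        (\<forall>j\<in>J. \<exists>h. homeomorphic_map (subtopology E {e\<in>topspace E. p e \<in> U j})
                                     (prod_topology (subtopology B (U j)) TG) h \<and>
                  (\<forall>e\<in>topspace E. p e \<in> U j \<longrightarrow> fst (h e) = p e) \<and>
                  (\<forall>e\<in>topspace E. \<forall>g\<in>carrier G. p e \<in> U j \<longrightarrow>
                       h (ract e g) = (p e, snd (h e) \<otimes>\<^bsub>G\<^esub> g))))"

end

theory Submission
  imports Defs
begin

text \<open>
  A motion planner on an open set of pairs of points of \<open>B\<close> is a family of paths, and such a family
  lifts \<open>G\<close>-equivariantly to \<open>E\<close>, because numerable principal bundles satisfy the covering homotopy
  theorem. Given \<open>[e, x]\<close> and \<open>[e', x']\<close>, lift the planned path from \<open>p e\<close> to \<open>p e'\<close> to a path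
  \<open>\<epsilon>\<close> starting at \<open>e\<close>. Its end point is \<open>e''\<close> with \<open>e' = e'' g\<close> for a unique \<open>g\<close>, so
  \<open>[e', x'] = [e'', g x']\<close>. An equivariant planner on \<open>X\<close> provides a path \<open>\<xi>\<close> from \<open>x\<close> to \<open>g x'\<close>,
  and \<open>t \<mapsto> [\<epsilon> t, \<xi> t]\<close> joins the given points. Another choice of representatives changes \<open>(x, g x')\<close>
  by the diagonal action only, so the construction descends to the quotient, and every pair of
  a planner domain for \<open>B\<close> and one for \<open>X\<close> yields a planner domain for \<open>X\<^sub>G\<close>.
\<close>

section \<open>Preliminaries\<close>

text \<open>\<open>TC\<close> and \<open>TC_G\<close> ask for sections only up to homotopy, whose
  paths need not join the prescribed points; these are first made strict by running the homotopy
  before and after each path, equivariantly in the case of \<open>TC_G\<close>. The main obstacle is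
  that lifts must be continuous in the base points, the time and the initial point at once, over an
  open subset of \<open>B \<times> B\<close> that carries no paracompactness assumption. Hence the
  covering homotopy theorem is stated as a lifting function \<open>\<Lambda> w t e\<close> for all
  \<open>e\<close> over the start of the path, and its equivariance in \<open>e\<close> is what
  permits the descent to the quotient. The pair \<open>(x, g x')\<close> depends on the planner on
  \<open>B\<close>, so a domain in \<open>X\<^sub>G\<close> is not an intersection of two
  independent preimages: the domain in \<open>B\<close> is fixed first, and only then can membership
  in a domain of \<open>X\<close> be tested. The descent needs a quotient map on the product of two
  copies of \<open>E \<times> X\<close> with the interval. Products of quotient maps need not be
  quotient maps, but \<open>q\<close> is an orbit map of a group action and hence open, and openness
  survives products and restriction to open sets.\<close>

lemma continuous_map_compose2:
  assumes "continuous_map (prod_topology A B) C (\<lambda>(a, b). f a b)"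
    and "continuous_map Y A g" and "continuous_map Y B h"
  shows "continuous_map Y C (\<lambda>y. f (g y) (h y))"
proof -
  have "continuous_map Y (prod_topology A B) (\<lambda>y. (g y, h y))"
    using assms(2,3) by (simp add: continuous_map_pairedI)
  from continuous_map_compose[OF this assms(1)] show ?thesis
    by (simp add: o_def)
qed

text \<open>Lets the local formula change from point to point: later maps are given by case
  distinctions, by lists of varying length or by a varying number of iterations, and agree with one
  continuous formula near each point.\<close>

lemma continuous_map_local:
  assumes "\<And>y. y \<in> topspace Y \<Longrightarrow>
    \<exists>V f'. openin Y V \<and> y \<in> V \<and> continuous_map (subtopology Y V) Z f' \<and> (\<forall>v\<in>V. f v = f' v)"
  shows "continuous_map Y Z f"
proof -
  from assms obtain V f' where V: "\<And>y. y \<in> topspace Y \<Longrightarrow> openin Y (V y)" "\<And>y. y \<in> topspace Y \<Longrightarrow> y \<in> V y"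
    and c: "\<And>y. y \<in> topspace Y \<Longrightarrow> continuous_map (subtopology Y (V y)) Z (f' y)"
    and eq: "\<And>y v. y \<in> topspace Y \<Longrightarrow> v \<in> V y \<Longrightarrow> f v = f' y v"
    by metis
  show ?thesis
  proof (rule pasting_lemma[where I = "topspace Y" and T = V and f = f'])
    show "f' i x = f' j x" if "i \<in> topspace Y" "j \<in> topspace Y" "x \<in> topspace Y \<inter> V i \<inter> V j" for i j x
      using eq that by (metis Int_iff)
  qed (use V c eq in blast)+
qed

section \<open>Infima over the unit interval and locally finite sums\<close>

text \<open>The infimum is upper semicontinuous because the projection along the interval is open,
  and lower semicontinuous because the interval is compact (tube lemma).\<close>

lemma continuous_map_INF_unit:
  fixes f :: "'a \<times> real \<Rightarrow> real"
  assumes f: "continuous_map (prod_topology Y unit_I) euclideanreal f"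
  shows "continuous_map Y euclideanreal (\<lambda>y. INF t\<in>{0..1}. f (y, t))"
    and "\<And>y. y \<in> topspace Y \<Longrightarrow> \<exists>t\<in>{0..1}. (INF t\<in>{0..1}. f (y, t)) = f (y, t)"
    and "\<And>y t. y \<in> topspace Y \<Longrightarrow> t \<in> {0..1} \<Longrightarrow> (INF t\<in>{0..1}. f (y, t)) \<le> f (y, t)"
proof -
  have c: "continuous_on {0..1} (\<lambda>t. f (y, t))" if "y \<in> topspace Y" for y
  proof -
    have "continuous_map unit_I (prod_topology Y unit_I) (\<lambda>t. (y, t))"
      using that by (intro continuous_map_pairedI) auto
    from continuous_map_compose[OF this f] show ?thesis by (simp add: o_def)
  qed
  have m: "\<exists>t\<in>{0..1}. \<forall>s\<in>{0..1}. f (y, t) \<le> f (y, s)" if "y \<in> topspace Y" for y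
    using continuous_attains_inf[OF _ _ c[OF that]] by auto
  have eq: "\<exists>t\<in>{0..1}. (INF t\<in>{0..1}. f (y, t)) = f (y, t) \<and> (\<forall>s\<in>{0..1}. f (y, t) \<le> f (y, s))"
    if y: "y \<in> topspace Y" for y
  proof -
    obtain t where t: "t \<in> {0..1}" "\<forall>s\<in>{0..1}. f (y, t) \<le> f (y, s)" using m[OF y] by blast
    have "(INF t\<in>{0..1}. f (y, t)) = f (y, t)"
      using t by (intro cInf_eq_minimum) auto
    with t show ?thesis by blast
  qed
  show "\<exists>t\<in>{0..1}. (INF t\<in>{0..1}. f (y, t)) = f (y, t)" if "y \<in> topspace Y" for y
    using eq[OF that] by blast
  show "(INF t\<in>{0..1}. f (y, t)) \<le> f (y, t)" if "y \<in> topspace Y" "t \<in> {0..1}" for y t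
    using eq[OF that(1)] that(2) by auto
  let ?m = "\<lambda>y. INF t\<in>{0..1}. f (y, t)"
  have lt: "openin Y {y \<in> topspace Y. ?m y < c}" for c
  proof -
    have "openin (prod_topology Y unit_I) {z \<in> topspace (prod_topology Y unit_I). f z \<in> {..<c}}"
      by (rule openin_continuous_map_preimage[OF f]) auto
    then have "openin Y (fst ` {z \<in> topspace (prod_topology Y unit_I). f z \<in> {..<c}})"
      using open_map_fst unfolding open_map_def by blast
    moreover have "fst ` {z \<in> topspace (prod_topology Y unit_I). f z \<in> {..<c}} = {y \<in> topspace Y. ?m y < c}"
    proof -
      have "y \<in> fst ` {z \<in> topspace (prod_topology Y unit_I). f z \<in> {..<c}} \<longleftrightarrow> y \<in> {y \<in> topspace Y. ?m y < c}" for y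
      proof (cases "y \<in> topspace Y")
        case True
        then obtain t where t: "t \<in> {0..1}" "?m y = f (y, t)" "\<forall>s\<in>{0..1}. f (y, t) \<le> f (y, s)"
          using eq by blast
        show ?thesis using True t by (force simp: image_iff)
      qed auto
      then show ?thesis by blast
    qed
    ultimately show ?thesis by simp
  qed
  have gt: "openin Y {y \<in> topspace Y. ?m y > c}" for c
  proof (subst openin_subopen, intro ballI)
    fix y assume y: "y \<in> {y \<in> topspace Y. ?m y > c}"
    then have yt: "y \<in> topspace Y" by simp
    let ?O = "{z \<in> topspace (prod_topology Y unit_I). f z \<in> {c<..}}"
    have O: "openin (prod_topology Y unit_I) ?O"
      by (rule openin_continuous_map_preimage[OF f]) auto
    have sub: "{y} \<times> {0..1} \<subseteq> ?O"
      using y eq[OF yt] by force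
    have C: "compactin unit_I {0..1::real}"
      by (simp add: compactin_subtopology)
    obtain U V where U: "openin Y U" "y \<in> U" "{0..1} \<subseteq> V" "U \<times> V \<subseteq> ?O"
      using tube_lemma_right[OF O C yt sub] by blast
    have "U \<subseteq> {y \<in> topspace Y. ?m y > c}"
    proof
      fix u assume u: "u \<in> U"
      then have ut: "u \<in> topspace Y" using U(1) openin_subset by blast
      obtain t where t: "t \<in> {0..1}" "?m u = f (u, t)" using eq[OF ut] by blast
      then have "(u, t) \<in> ?O" using U(3,4) u by blast
      then show "u \<in> {y \<in> topspace Y. ?m y > c}" using t(2) ut by simp
    qed
    then show "\<exists>T. openin Y T \<and> y \<in> T \<and> T \<subseteq> {y \<in> topspace Y. ?m y > c}" using U by blast
  qed
  show "continuous_map Y euclideanreal ?m"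
    using lt gt by (simp add: continuous_map_upper_lower_semicontinuous_lt)
qed

text \<open>The index set of the sum varies with the point, but on a neighbourhood meeting finitely
  many supports it can be replaced by one fixed finite set, which only adds zeros.\<close>

lemma continuous_map_locally_finite_sum:
  fixes f :: "'j \<Rightarrow> 'a \<Rightarrow> real"
  assumes f: "\<And>j. j \<in> J \<Longrightarrow> continuous_map Y euclideanreal (f j)"
    and lf: "\<And>y. y \<in> topspace Y \<Longrightarrow> \<exists>V. openin Y V \<and> y \<in> V \<and> finite {j\<in>J. \<exists>v\<in>V. f j v \<noteq> 0}"
  shows "continuous_map Y euclideanreal (\<lambda>y. \<Sum>j\<in>{j\<in>J. f j y \<noteq> 0}. f j y)"
proof (rule continuous_map_local)
  fix y assume "y \<in> topspace Y"
  then obtain V where V: "openin Y V" "y \<in> V" "finite {j\<in>J. \<exists>v\<in>V. f j v \<noteq> 0}" using lf by blast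
  let ?A = "{j\<in>J. \<exists>v\<in>V. f j v \<noteq> 0}"
  have "continuous_map (subtopology Y V) euclideanreal (\<lambda>y. \<Sum>j\<in>?A. f j y)"
    using V(3) f by (intro continuous_map_sum continuous_map_from_subtopology) auto
  moreover have "(\<Sum>j\<in>{j\<in>J. f j v \<noteq> 0}. f j v) = (\<Sum>j\<in>?A. f j v)" if "v \<in> V" for v
    using that V(3) by (intro sum.mono_neutral_left) auto
  ultimately show "\<exists>V f'. openin Y V \<and> y \<in> V \<and> continuous_map (subtopology Y V) euclideanreal f' \<and>
      (\<forall>v\<in>V. (\<Sum>j\<in>{j\<in>J. f j v \<noteq> 0}. f j v) = f' v)"
    using V(1,2) by blast
qed

text \<open>A fixed well-order of the index type makes these orderings compatible with passing to subsets,
  so that near a given point a composite over the active indices does not depend on which finite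
  set containing them is used.\<close>

lemma coherent_enumerations:
  obtains L :: "'j set \<Rightarrow> 'j list" where
    "\<And>A. finite A \<Longrightarrow> set (L A) = A \<and> distinct (L A)"
    "\<And>A P. finite A \<Longrightarrow> L {a\<in>A. P a} = filter P (L A)"
proof -
  obtain r :: "'j rel" where "well_order_on UNIV r" using well_ordering by (metis card_of_well_order_on)
  then have lin: "linear_order r" by (simp add: well_order_on_def)
  define le where "le x y \<longleftrightarrow> (x, y) \<in> r" for x y
  interpret linorder le "\<lambda>x y. le x y \<and> x \<noteq> y"
    using lin unfolding linear_order_on_def partial_order_on_def preorder_on_def le_def
    by unfold_locales (auto simp: total_on_def dest: antisymD transD refl_onD, metis reflD)
  show thesis
  proof
    show "set (sorted_list_of_set A) = A \<and> distinct (sorted_list_of_set A)" if "finite A" for A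
      using that by simp
    show "sorted_list_of_set {a\<in>A. P a} = filter P (sorted_list_of_set A)" if "finite A" for A P
      using that sorted_wrt_filter[of le "sorted_list_of_set A"]
      by (intro sorted_distinct_set_unique) auto
  qed
qed

section \<open>Path spaces and the exponential law\<close>

lemma path_space_topspace: "topspace (path_space X) = path_carrier X"
proof -
  \<comment> \<open>The empty compact set imposes no condition, so the whole carrier is itself a
    subbasic set.\<close>
  have "path_carrier X \<in> {{\<gamma> \<in> path_carrier X. \<gamma> ` K \<subseteq> U} | K U. compactin unit_I K \<and> openin X U}"
    by (rule CollectI, rule exI[of _ "{}"], rule exI[of _ "{}"]) auto
  then show ?thesis
    unfolding path_space_def topspace_subtopology topology_generated_by_topspace by blast
qed

lemma openin_path_space_subbasis:
  assumes "compactin unit_I K" and "openin X U"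
  shows "openin (path_space X) {\<gamma> \<in> path_carrier X. \<gamma> ` K \<subseteq> U}"
proof -
  let ?S = "{{\<gamma> \<in> path_carrier X. \<gamma> ` K \<subseteq> U} | K U. compactin unit_I K \<and> openin X U}"
  have "openin (topology_generated_by ?S) {\<gamma> \<in> path_carrier X. \<gamma> ` K \<subseteq> U}"
    using assms by (intro topology_generated_by_Basis) blast
  then show ?thesis
    unfolding path_space_def openin_subtopology by blast
qed

text \<open>The uncurrying half of the exponential law. It rests on local compactness of the
  interval: \<open>t\<close> has a compact neighbourhood \<open>K\<close> that \<open>s y\<close>
  maps into \<open>U\<close>, and mapping \<open>K\<close> into \<open>U\<close> is an open
  condition on paths.\<close>

lemma continuous_map_path_space_eval:
  assumes s: "continuous_map Y (path_space X) s"
  shows "continuous_map (prod_topology Y unit_I) X (\<lambda>(y, t). s y t)"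
proof -
  have car: "s y \<in> path_carrier X" if "y \<in> topspace Y" for y
    using continuous_map_image_subset_topspace[OF s] that by (auto simp: path_space_topspace)
  then have cont: "continuous_map unit_I X (s y)" if "y \<in> topspace Y" for y
    using that by (auto simp: path_carrier_def)
  have st: "s y t \<in> topspace X" if "y \<in> topspace Y" "t \<in> {0..1}" for y t
    using continuous_map_image_subset_topspace[OF cont[OF that(1)]] that(2) by auto
  have "openin (prod_topology Y unit_I) {z \<in> topspace (prod_topology Y unit_I). (case z of (y,t) \<Rightarrow> s y t) \<in> U}"
    if U: "openin X U" for U
  proof (subst openin_subopen, intro ballI)
    fix z assume z: "z \<in> {z \<in> topspace (prod_topology Y unit_I). (case z of (y,t) \<Rightarrow> s y t) \<in> U}"
    obtain y t where [simp]: "z = (y, t)" by (cases z)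
    have y: "y \<in> topspace Y" and t: "t \<in> {0..1}" and tU: "s y t \<in> U" using z by auto
    have O: "openin unit_I {t \<in> {0..1}. s y t \<in> U}"
      using openin_continuous_map_preimage[OF cont[OF y] U] by simp
    have "neighbourhood_base_of (\<lambda>C. compactin unit_I C) unit_I"
      using locally_compact_space_neighbourhood_base[of unit_I]
      by (simp add: compact_imp_locally_compact_space compact_space_subtopology Hausdorff_space_subtopology)

    then have "\<forall>W x. openin unit_I W \<and> x \<in> W \<longrightarrow>
        (\<exists>N K. openin unit_I N \<and> compactin unit_I K \<and> x \<in> N \<and> N \<subseteq> K \<and> K \<subseteq> W)"
      by (simp add: neighbourhood_base_of)
    from this[rule_format, of "{t \<in> {0..1}. s y t \<in> U}" t]
    have "\<exists>N K. openin unit_I N \<and> compactin unit_I K \<and> t \<in> N \<and> N \<subseteq> K \<and> K \<subseteq> {t \<in> {0..1}. s y t \<in> U}"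
      using O t tU by simp
    then obtain N K where N: "openin unit_I N" "t \<in> N" "N \<subseteq> K" "K \<subseteq> {t \<in> {0..1}. s y t \<in> U}" "compactin unit_I K"
      by blast
    let ?P = "{v \<in> topspace Y. s v \<in> {\<gamma> \<in> path_carrier X. \<gamma> ` K \<subseteq> U}}"
    have "openin Y ?P"
      by (rule openin_continuous_map_preimage[OF s openin_path_space_subbasis[OF N(5) U]])
    then have "openin (prod_topology Y unit_I) (?P \<times> N)"
      using N(1) by (simp add: openin_prod_Times_iff)
    moreover have "z \<in> ?P \<times> N"
    proof -
      have "s y ` K \<subseteq> U" using N(4) by blast
      then show ?thesis using y car[OF y] N(2) by simp
    qed
    moreover have "?P \<times> N \<subseteq> {z \<in> topspace (prod_topology Y unit_I). (case z of (y,t) \<Rightarrow> s y t) \<in> U}"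
    proof
      fix z' assume "z' \<in> ?P \<times> N"
      then obtain y' t' where z': "z' = (y', t')" "y' \<in> topspace Y" "s y' ` K \<subseteq> U" "t' \<in> N" by blast
      moreover from this have "t' \<in> K" "t' \<in> {0..1}" using N(3,4) by blast+
      ultimately show "z' \<in> {z \<in> topspace (prod_topology Y unit_I). (case z of (y,t) \<Rightarrow> s y t) \<in> U}"
        by auto
    qed
    ultimately show "\<exists>T. openin (prod_topology Y unit_I) T \<and> z \<in> T \<and>
        T \<subseteq> {z \<in> topspace (prod_topology Y unit_I). (case z of (y,t) \<Rightarrow> s y t) \<in> U}"
      by blast
  qed
  then show ?thesis
    using st by (auto simp: continuous_map_def)
qed

text \<open>The currying half of the exponential law: preimages of subbasic sets are open by the
  tube lemma along the compact set \<open>K\<close>. The \<open>restrict\<close> picks the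
  extensional representative that \<open>path_carrier\<close> demands.\<close>

lemma continuous_map_into_path_space:
  assumes f: "continuous_map (prod_topology Y unit_I) X f"
  shows "continuous_map Y (path_space X) (\<lambda>y. restrict (\<lambda>t. f (y, t)) {0..1})"
proof -
  let ?s = "\<lambda>y. restrict (\<lambda>t. f (y, t)) {0..1}"
  let ?S = "{{\<gamma> \<in> path_carrier X. \<gamma> ` K \<subseteq> U} | K U. compactin unit_I K \<and> openin X U}"
  have "continuous_map unit_I X (\<lambda>t. f (y, t))" if "y \<in> topspace Y" for y
  proof -
    have "continuous_map unit_I (prod_topology Y unit_I) (\<lambda>t. (y, t))"
      using that by (intro continuous_map_pairedI) auto
    from continuous_map_compose[OF this f] show ?thesis by (simp add: o_def)
  qed
  then have "continuous_map unit_I X (?s y)" if "y \<in> topspace Y" for y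
    using that by (rule_tac continuous_map_eq[of _ _ "\<lambda>t. f (y, t)"]) auto
  then have car: "?s y \<in> path_carrier X" if "y \<in> topspace Y" for y
    using that by (simp add: path_carrier_def)
  have op: "openin Y (?s -` {\<gamma> \<in> path_carrier X. \<gamma> ` K \<subseteq> U} \<inter> topspace Y)"
    if K: "compactin unit_I K" and U: "openin X U" for K U
  proof (subst openin_subopen, intro ballI)
    fix y assume y: "y \<in> ?s -` {\<gamma> \<in> path_carrier X. \<gamma> ` K \<subseteq> U} \<inter> topspace Y"
    have K01: "K \<subseteq> {0..1}" using compactin_subset_topspace[OF K] by simp
    let ?O = "{z \<in> topspace (prod_topology Y unit_I). f z \<in> U}"
    have O: "openin (prod_topology Y unit_I) ?O"
      by (rule openin_continuous_map_preimage[OF f U])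
    have yt: "y \<in> topspace Y" using y by blast
    have "{y} \<times> K \<subseteq> ?O" using y K01 by (auto simp: image_subset_iff subset_iff)
    from tube_lemma_right[OF O K yt this] obtain V V' where V: "openin Y V" "y \<in> V" "K \<subseteq> V'" "V \<times> V' \<subseteq> ?O" by blast
    have "V \<subseteq> ?s -` {\<gamma> \<in> path_carrier X. \<gamma> ` K \<subseteq> U} \<inter> topspace Y"
    proof
      fix v assume v: "v \<in> V"
      then have vt: "v \<in> topspace Y" using openin_subset[OF V(1)] by blast
      have "f (v, t) \<in> U" if "t \<in> K" for t using v that V(3,4) by blast
      then have "?s v ` K \<subseteq> U" using K01 by auto
      then show "v \<in> ?s -` {\<gamma> \<in> path_carrier X. \<gamma> ` K \<subseteq> U} \<inter> topspace Y" using vt car by simp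
    qed
    then show "\<exists>T. openin Y T \<and> y \<in> T \<and> T \<subseteq> ?s -` {\<gamma> \<in> path_carrier X. \<gamma> ` K \<subseteq> U} \<inter> topspace Y"
      using V by blast
  qed
  have "continuous_map Y (topology_generated_by ?S) ?s"
  proof (rule continuous_on_generated_topo)
    show "openin Y (?s -` W \<inter> topspace Y)" if "W \<in> ?S" for W using that op by blast
    have "path_carrier X \<in> ?S"
      by (rule CollectI, rule exI[of _ "{}"], rule exI[of _ "{}"]) auto
    then show "?s ` topspace Y \<subseteq> \<Union> ?S" using car by blast
  qed
  then show ?thesis
    unfolding path_space_def by (rule continuous_map_into_subtopology) (use car in auto)
qed

section \<open>Equivariant covering homotopies\<close>

text \<open>Axiomatises what path lifting needs from a bundle: \<open>\<tau> j c e\<close> carries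
  \<open>e\<close> to the fibre over \<open>c\<close> inside the chart where \<open>\<phi> j\<close>
  is positive. The structure group enters only through \<open>S\<close>, a set of fibrewise maps
  commuting with transport, so that equivariance is carried along without group
  computations.\<close>

locale local_transport =
  fixes E :: "'e topology" and B :: "'b topology" and p :: "'e \<Rightarrow> 'b"
    and J :: "'j set" and \<phi> :: "'j \<Rightarrow> 'b \<Rightarrow> real" and \<tau> :: "'j \<Rightarrow> 'b \<Rightarrow> 'e \<Rightarrow> 'e"
    and S :: "('e \<Rightarrow> 'e) set"
  assumes p_cont: "continuous_map E B p"
    and \<phi>_cont: "\<And>j. j \<in> J \<Longrightarrow> continuous_map B euclideanreal (\<phi> j)"
    and \<phi>_nonneg: "\<And>j b. j \<in> J \<Longrightarrow> b \<in> topspace B \<Longrightarrow> 0 \<le> \<phi> j b"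
    and \<phi>_locally_finite: "\<And>b. b \<in> topspace B \<Longrightarrow>
      \<exists>V. openin B V \<and> b \<in> V \<and> finite {j\<in>J. \<exists>c\<in>V. 0 < \<phi> j c}"
    and \<phi>_cover: "\<And>b. b \<in> topspace B \<Longrightarrow> \<exists>j\<in>J. 0 < \<phi> j b"
    and \<tau>_cont: "\<And>j. j \<in> J \<Longrightarrow>
      continuous_map (subtopology (prod_topology B E) {(c, e). 0 < \<phi> j c \<and> 0 < \<phi> j (p e)}) E (\<lambda>(c, e). \<tau> j c e)"
    and \<tau>_over: "\<And>j c e. j \<in> J \<Longrightarrow> c \<in> topspace B \<Longrightarrow> e \<in> topspace E \<Longrightarrow>
      0 < \<phi> j c \<Longrightarrow> 0 < \<phi> j (p e) \<Longrightarrow> p (\<tau> j c e) = c"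
    and \<tau>_refl: "\<And>j e. j \<in> J \<Longrightarrow> e \<in> topspace E \<Longrightarrow> 0 < \<phi> j (p e) \<Longrightarrow> \<tau> j (p e) e = e"
    and S_fibrewise: "\<And>\<sigma> e. \<sigma> \<in> S \<Longrightarrow> e \<in> topspace E \<Longrightarrow> \<sigma> e \<in> topspace E \<and> p (\<sigma> e) = p e"
    and \<tau>_equivariant: "\<And>j c e \<sigma>. j \<in> J \<Longrightarrow> c \<in> topspace B \<Longrightarrow> e \<in> topspace E \<Longrightarrow>
      0 < \<phi> j c \<Longrightarrow> 0 < \<phi> j (p e) \<Longrightarrow> \<sigma> \<in> S \<Longrightarrow> \<tau> j c (\<sigma> e) = \<sigma> (\<tau> j c e)"
begin

lemma \<tau>_topspace:
  assumes "j \<in> J" "c \<in> topspace B" "e \<in> topspace E" "0 < \<phi> j c" "0 < \<phi> j (p e)"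
  shows "\<tau> j c e \<in> topspace E"
  using subsetD[OF continuous_map_image_subset_topspace[OF \<tau>_cont[OF assms(1)]] imageI[of "(c, e)"]] assms
  by simp

text \<open>With \<open>\<rho> j (w, a)\<close> the infimum over \<open>t\<close> of \<open>\<phi> j (F (w, t)) + \<bar>t - a\<bar>\<close>, the path \<open>F (w, -)\<close>
  stays in the \<open>j\<close>-th chart for time \<open>\<rho> j (w, a)\<close> around \<open>a\<close>, and \<open>\<rho> j\<close> vanishes where \<open>\<phi> j \<circ> F\<close>
  does, hence inherits local finiteness. The ratio of \<open>\<Sum>\<rho>\<^sup>2\<close> to \<open>\<Sum>\<rho>\<close> is a continuous positive lower bound for
  the largest \<open>\<rho> j\<close>, so a continuous step size exists over an arbitrary base \<open>W\<close>, without the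
  countable refinement usually needed for covering homotopies of numerable bundles.\<close>

lemma step_size:
  assumes F: "continuous_map (prod_topology W unit_I) B F"
  obtains \<delta> \<gamma> where
    "continuous_map W euclideanreal \<delta>"
    "\<And>w. w \<in> topspace W \<Longrightarrow> 0 < \<delta> w"
    "\<And>j. j \<in> J \<Longrightarrow> continuous_map (prod_topology W unit_I) euclideanreal (\<gamma> j)"
    "\<And>j z. j \<in> J \<Longrightarrow> z \<in> topspace (prod_topology W unit_I) \<Longrightarrow> 0 \<le> \<gamma> j z"
    "\<And>z. z \<in> topspace (prod_topology W unit_I) \<Longrightarrow>
      \<exists>V. openin (prod_topology W unit_I) V \<and> z \<in> V \<and> finite {j\<in>J. \<exists>v\<in>V. \<gamma> j v \<noteq> 0}"
    "\<And>z. z \<in> topspace (prod_topology W unit_I) \<Longrightarrow> (\<Sum>j\<in>{j\<in>J. \<gamma> j z \<noteq> 0}. \<gamma> j z) = 1"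
    "\<And>j. j \<in> J \<Longrightarrow> \<exists>D N. openin (prod_topology W unit_I) D \<and> openin (prod_topology W unit_I) N \<and>
      topspace (prod_topology W unit_I) \<subseteq> D \<union> N \<and>
      (\<forall>(w, a)\<in>D. \<forall>t\<in>{0..1}. \<bar>t - a\<bar> \<le> \<delta> w \<longrightarrow> 0 < \<phi> j (F (w, t))) \<and> (\<forall>z\<in>N. \<gamma> j z = 0)"
proof -
  let ?Z = "prod_topology W unit_I"
  define f where "f j = (\<lambda>(z, t). \<phi> j (F (fst z, t)) + \<bar>t - snd z\<bar>)" for j
  define \<rho> where "\<rho> j z = (INF t\<in>{0..1}. f j (z, t))" for j z
  have Ft: "F z \<in> topspace B" if "z \<in> topspace ?Z" for z
    using continuous_map_image_subset_topspace[OF F] that by blast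
  have f_cont: "continuous_map (prod_topology ?Z unit_I) euclideanreal (f j)" if "j \<in> J" for j
  proof -
    have "continuous_map (prod_topology ?Z unit_I) ?Z (\<lambda>x. (fst (fst x), snd x))"
      by (intro continuous_map_pairedI continuous_map_compose[OF continuous_map_fst continuous_map_fst, unfolded o_def]
          continuous_map_snd)
    from continuous_map_compose[OF this continuous_map_compose[OF F \<phi>_cont[OF that]]]
    have 1: "continuous_map (prod_topology ?Z unit_I) euclideanreal (\<lambda>x. \<phi> j (F (fst (fst x), snd x)))"
      by (simp add: o_def)
    have 2: "continuous_map (prod_topology ?Z unit_I) euclideanreal (\<lambda>x. snd x)"
      using continuous_map_snd[of ?Z unit_I] by (simp add: continuous_map_in_subtopology)
    have "continuous_map ?Z euclideanreal snd"
      using continuous_map_snd[of W unit_I] by (simp add: continuous_map_in_subtopology)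
    from continuous_map_compose[OF continuous_map_fst this]
    have 3: "continuous_map (prod_topology ?Z unit_I) euclideanreal (\<lambda>x. snd (fst x))"
      by (simp add: o_def)
    show ?thesis
      unfolding f_def case_prod_unfold
      by (intro continuous_map_add continuous_map_real_abs continuous_map_diff 1 2 3)
  qed
  have \<rho>_cont: "continuous_map ?Z euclideanreal (\<rho> j)" if "j \<in> J" for j
    unfolding \<rho>_def by (rule continuous_map_INF_unit(1)[OF f_cont[OF that]])
  have \<rho>_le: "\<rho> j (w, a) \<le> \<phi> j (F (w, t)) + \<bar>t - a\<bar>"
    if "j \<in> J" "w \<in> topspace W" "a \<in> {0..1}" "t \<in> {0..1}" for j w a t
    using continuous_map_INF_unit(3)[OF f_cont[OF that(1)], of "(w, a)" t] that
    by (simp add: \<rho>_def f_def)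
  have \<rho>_att: "\<exists>t\<in>{0..1}. \<rho> j (w, a) = \<phi> j (F (w, t)) + \<bar>t - a\<bar>"
    if "j \<in> J" "w \<in> topspace W" "a \<in> {0..1}" for j w a
    using continuous_map_INF_unit(2)[OF f_cont[OF that(1)], of "(w, a)"] that
    by (simp add: \<rho>_def f_def)
  have \<rho>_nonneg: "0 \<le> \<rho> j z" if "j \<in> J" "z \<in> topspace ?Z" for j z
  proof -
    obtain w a where z: "z = (w, a)" "w \<in> topspace W" "a \<in> {0..1}" using \<open>z \<in> topspace ?Z\<close> by auto
    then obtain t where t: "t \<in> {0..1}" "\<rho> j z = \<phi> j (F (w, t)) + \<bar>t - a\<bar>" using \<rho>_att[OF \<open>j \<in> J\<close>] by blast
    moreover have "0 \<le> \<phi> j (F (w, t))" using \<phi>_nonneg[OF that(1)] Ft z t(1) by simp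
    ultimately show ?thesis by simp
  qed
  have \<rho>_pos: "0 < \<rho> j z" if "j \<in> J" "z \<in> topspace ?Z" "0 < \<phi> j (F z)" for j z
  proof -
    obtain w a where z: "z = (w, a)" "w \<in> topspace W" "a \<in> {0..1}" using \<open>z \<in> topspace ?Z\<close> by auto
    then obtain t where t: "t \<in> {0..1}" "\<rho> j z = \<phi> j (F (w, t)) + \<bar>t - a\<bar>" using \<rho>_att[OF \<open>j \<in> J\<close>] by blast
    moreover have "0 \<le> \<phi> j (F (w, t))" using \<phi>_nonneg[OF that(1)] Ft z t(1) by simp
    ultimately show ?thesis using that(3) z(1) by (cases "t = a") auto
  qed
  have \<rho>_lf: "\<exists>V. openin ?Z V \<and> z \<in> V \<and> finite {j\<in>J. \<exists>v\<in>V. \<rho> j v \<noteq> 0}" if "z \<in> topspace ?Z" for z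
  proof -
    obtain V where V: "openin B V" "F z \<in> V" "finite {j\<in>J. \<exists>c\<in>V. 0 < \<phi> j c}"
      using \<phi>_locally_finite[OF Ft[OF \<open>z \<in> topspace ?Z\<close>]] by blast
    let ?V = "{z \<in> topspace ?Z. F z \<in> V}"
    have "openin ?Z ?V" by (rule openin_continuous_map_preimage[OF F V(1)])
    moreover have "{j\<in>J. \<exists>v\<in>?V. \<rho> j v \<noteq> 0} \<subseteq> {j\<in>J. \<exists>c\<in>V. 0 < \<phi> j c}"
    proof
      fix j assume "j \<in> {j\<in>J. \<exists>v\<in>?V. \<rho> j v \<noteq> 0}"
      then obtain v where j: "j \<in> J" and v: "v \<in> topspace ?Z" "F v \<in> V" "\<rho> j v \<noteq> 0" by blast
      have "\<rho> j v \<le> \<phi> j (F v)" using \<rho>_le[OF j, of "fst v" "snd v" "snd v"] v(1) by (cases v) auto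
      then have "0 < \<phi> j (F v)" using \<rho>_nonneg[OF j v(1)] v(3) by linarith
      then show "j \<in> {j\<in>J. \<exists>c\<in>V. 0 < \<phi> j c}" using j v(2) by blast
    qed
    ultimately show ?thesis using V that by (intro exI[of _ ?V]) (auto intro: finite_subset)
  qed
  have \<rho>_fin: "finite {j\<in>J. \<rho> j z \<noteq> 0}" if "z \<in> topspace ?Z" for z
  proof -
    obtain V where "z \<in> V" "finite {j\<in>J. \<exists>v\<in>V. \<rho> j v \<noteq> 0}" using \<rho>_lf[OF \<open>z \<in> topspace ?Z\<close>] by blast
    then show ?thesis by (auto elim!: rev_finite_subset)
  qed
  define S1 where "S1 z = (\<Sum>j\<in>{j\<in>J. \<rho> j z \<noteq> 0}. \<rho> j z)" for z
  define S2 where "S2 z = (\<Sum>j\<in>{j\<in>J. \<rho> j z \<noteq> 0}. (\<rho> j z)\<^sup>2)" for z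
  \<comment> \<open>This is the mean of the \<open>\<rho> j\<close> with weights
    \<open>\<rho> j\<close>. A mean cannot exceed all of its terms, which yields an index with
    \<open>\<theta> z \<le> \<rho> j z\<close>.\<close>
  define \<theta> where "\<theta> z = S2 z / S1 z" for z
  have S1_cont: "continuous_map ?Z euclideanreal S1"
    unfolding S1_def by (rule continuous_map_locally_finite_sum[OF \<rho>_cont \<rho>_lf])
  have S2_cont: "continuous_map ?Z euclideanreal S2"
    unfolding S2_def
    using continuous_map_locally_finite_sum[of J ?Z "\<lambda>j z. (\<rho> j z)\<^sup>2"] \<rho>_cont \<rho>_lf
    by (simp add: continuous_map_real_pow)
  have ne: "{j\<in>J. \<rho> j z \<noteq> 0} \<noteq> {}" if "z \<in> topspace ?Z" for z
  proof -
    obtain j where "j \<in> J" "0 < \<phi> j (F z)" using \<phi>_cover[OF Ft[OF \<open>z \<in> topspace ?Z\<close>]] by blast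
    then show ?thesis using \<rho>_pos[OF _ that] by force
  qed
  have S1_pos: "0 < S1 z" if "z \<in> topspace ?Z" for z
    unfolding S1_def using \<rho>_nonneg[OF _ that]
    by (intro sum_pos \<rho>_fin[OF that] ne[OF that]) (auto simp: less_le)
  have S2_pos: "0 < S2 z" if "z \<in> topspace ?Z" for z
    unfolding S2_def by (intro sum_pos \<rho>_fin[OF that] ne[OF that]) auto
  have \<theta>_pos: "0 < \<theta> z" if "z \<in> topspace ?Z" for z
    unfolding \<theta>_def using S1_pos[OF that] S2_pos[OF that] by simp
  have \<theta>_cont: "continuous_map ?Z euclideanreal \<theta>"
    unfolding \<theta>_def using S1_pos by (intro continuous_map_real_divide S1_cont S2_cont) force
  have \<theta>_le: "\<exists>j\<in>J. \<theta> z \<le> \<rho> j z" if z: "z \<in> topspace ?Z" for z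
  proof (rule ccontr)
    assume "\<not> ?thesis"
    then have lt: "\<rho> j z < \<theta> z" if "j \<in> J" for j using that by force
    have "S2 z < (\<Sum>j\<in>{j\<in>J. \<rho> j z \<noteq> 0}. \<theta> z * \<rho> j z)"
      unfolding S2_def
    proof (rule sum_strict_mono[OF \<rho>_fin[OF z] ne[OF z]])
      fix j assume "j \<in> {j\<in>J. \<rho> j z \<noteq> 0}"
      then have "0 < \<rho> j z" "\<rho> j z < \<theta> z" using \<rho>_nonneg[OF _ z] lt by (auto simp: less_le)
      then show "(\<rho> j z)\<^sup>2 < \<theta> z * \<rho> j z" by (simp add: power2_eq_square)
    qed
    also have "\<dots> = \<theta> z * S1 z" by (simp add: S1_def sum_distrib_left)
    also have "\<dots> = S2 z" using S1_pos[OF z] by (simp add: \<theta>_def)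
    finally show False by simp
  qed
  \<comment> \<open>The infimum over \<open>a\<close> makes the step size depend on the path alone.
    At each time some \<open>\<rho> j\<close> is at least \<open>3 * \<delta> w\<close>, which
    leaves room for two thresholds below it: weights are cut off at \<open>2 * \<delta> w\<close>,
    while the chart \<open>j\<close> is already safe above \<open>\<delta> w\<close>.\<close>
  define \<delta> where "\<delta> w = (INF a\<in>{0..1}. \<theta> (w, a)) / 3" for w
  have \<delta>_cont: "continuous_map W euclideanreal \<delta>"
    unfolding \<delta>_def by (intro continuous_map_real_divide continuous_map_INF_unit(1)[OF \<theta>_cont]) auto
  have \<delta>_pos: "0 < \<delta> w" if "w \<in> topspace W" for w
    using continuous_map_INF_unit(2)[OF \<theta>_cont that] \<theta>_pos that unfolding \<delta>_def by force
  have \<delta>_le: "3 * \<delta> w \<le> \<theta> (w, a)" if "w \<in> topspace W" "a \<in> {0..1}" for w a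
    using continuous_map_INF_unit(3)[OF \<theta>_cont that] unfolding \<delta>_def by simp
  have \<delta>_cont': "continuous_map ?Z euclideanreal (\<lambda>z. \<delta> (fst z))"
    using continuous_map_compose[OF continuous_map_fst \<delta>_cont] by (simp add: o_def)
  define g where "g j z = max 0 (\<rho> j z - 2 * \<delta> (fst z))" for j z
  have g_cont: "continuous_map ?Z euclideanreal (g j)" if "j \<in> J" for j
    unfolding g_def
    by (intro continuous_map_real_max continuous_map_diff \<rho>_cont[OF that] continuous_map_real_mult \<delta>_cont') auto
  have g_\<rho>: "\<rho> j z \<noteq> 0" if "z \<in> topspace ?Z" "g j z \<noteq> 0" for j z
    using that \<delta>_pos[of "fst z"] by (auto simp: g_def max_def split: if_splits)
  have g_lf: "\<exists>V. openin ?Z V \<and> z \<in> V \<and> finite {j\<in>J. \<exists>v\<in>V. g j v \<noteq> 0}" if "z \<in> topspace ?Z" for z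
  proof -
    obtain V where V: "openin ?Z V" "z \<in> V" "finite {j\<in>J. \<exists>v\<in>V. \<rho> j v \<noteq> 0}" using \<rho>_lf[OF \<open>z \<in> topspace ?Z\<close>] by blast
    moreover have "{j\<in>J. \<exists>v\<in>V. g j v \<noteq> 0} \<subseteq> {j\<in>J. \<exists>v\<in>V. \<rho> j v \<noteq> 0}"
      using g_\<rho> openin_subset[OF V(1)] by blast
    ultimately show ?thesis using finite_subset by blast
  qed
  define G where "G z = (\<Sum>j\<in>{j\<in>J. g j z \<noteq> 0}. g j z)" for z
  have G_cont: "continuous_map ?Z euclideanreal G"
    unfolding G_def by (rule continuous_map_locally_finite_sum[OF g_cont g_lf])
  have G_pos: "0 < G z" if z: "z \<in> topspace ?Z" for z
  proof -
    have "{j\<in>J. g j z \<noteq> 0} \<subseteq> {j\<in>J. \<rho> j z \<noteq> 0}" using g_\<rho>[OF z] by blast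
    then have fin: "finite {j\<in>J. g j z \<noteq> 0}" using \<rho>_fin[OF z] finite_subset by blast
    obtain j where j: "j \<in> J" "\<theta> z \<le> \<rho> j z" using \<theta>_le[OF z] by blast
    have "3 * \<delta> (fst z) \<le> \<theta> z" "0 < \<delta> (fst z)" using \<delta>_le[of "fst z" "snd z"] \<delta>_pos z by auto
    then have "g j z \<noteq> 0" using j(2) by (simp add: g_def)
    then have "{j\<in>J. g j z \<noteq> 0} \<noteq> {}" using j(1) by blast
    then show ?thesis unfolding G_def by (intro sum_pos fin) (auto simp: g_def less_le)
  qed
  define \<gamma> where "\<gamma> j z = g j z / G z" for j z
  have \<gamma>0: "\<gamma> j z \<noteq> 0 \<longleftrightarrow> g j z \<noteq> 0" if "z \<in> topspace ?Z" for j z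
    using G_pos[OF that] by (simp add: \<gamma>_def)
  show thesis
  proof (rule that[of \<delta> \<gamma>])
    show "continuous_map ?Z euclideanreal (\<gamma> j)" if "j \<in> J" for j
      unfolding \<gamma>_def using G_pos by (intro continuous_map_real_divide g_cont[OF that] G_cont) force
    show "0 \<le> \<gamma> j z" if "j \<in> J" "z \<in> topspace ?Z" for j z
      using G_pos[OF that(2)] by (simp add: \<gamma>_def g_def)
    show "\<exists>V. openin ?Z V \<and> z \<in> V \<and> finite {j\<in>J. \<exists>v\<in>V. \<gamma> j v \<noteq> 0}" if "z \<in> topspace ?Z" for z
    proof -
      obtain V where V: "openin ?Z V" "z \<in> V" "finite {j\<in>J. \<exists>v\<in>V. g j v \<noteq> 0}" using g_lf[OF \<open>z \<in> topspace ?Z\<close>] by blast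
      moreover have "{j\<in>J. \<exists>v\<in>V. \<gamma> j v \<noteq> 0} \<subseteq> {j\<in>J. \<exists>v\<in>V. g j v \<noteq> 0}"
        using \<gamma>0 openin_subset[OF V(1)] by blast
      ultimately show ?thesis using finite_subset by blast
    qed
    show "(\<Sum>j\<in>{j\<in>J. \<gamma> j z \<noteq> 0}. \<gamma> j z) = 1" if "z \<in> topspace ?Z" for z
    proof -
      have "(\<Sum>j\<in>{j\<in>J. \<gamma> j z \<noteq> 0}. \<gamma> j z) = G z / G z"
        unfolding \<gamma>0[OF that] unfolding \<gamma>_def by (simp add: sum_divide_distrib[symmetric] G_def)
      then show ?thesis using G_pos[OF that] by simp
    qed
    show "\<exists>D N. openin ?Z D \<and> openin ?Z N \<and> topspace ?Z \<subseteq> D \<union> N \<and>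
      (\<forall>(w, a)\<in>D. \<forall>t\<in>{0..1}. \<bar>t - a\<bar> \<le> \<delta> w \<longrightarrow> 0 < \<phi> j (F (w, t))) \<and> (\<forall>z\<in>N. \<gamma> j z = 0)"
      if j: "j \<in> J" for j
    proof (intro exI conjI)
      \<comment> \<open>The two thresholds make these open sets overlap, so they cover. On
        \<open>?D\<close> the inequality \<open>\<rho>_le\<close> gives that
        \<open>\<phi> j (F (w, t))\<close> is at least \<open>\<rho> j (w, a)\<close> minus the
        distance from \<open>a\<close> to \<open>t\<close>, hence positive for distances up to
        \<open>\<delta> w\<close>.\<close>
      let ?D = "{z \<in> topspace ?Z. \<rho> j z - \<delta> (fst z) \<in> {0<..}}"
      let ?N = "{z \<in> topspace ?Z. \<rho> j z - 2 * \<delta> (fst z) \<in> {..<0}}"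
      show "openin ?Z ?D"
        by (rule openin_continuous_map_preimage[where Y = euclideanreal])
          (auto intro!: continuous_map_diff \<rho>_cont[OF j] \<delta>_cont')
      show "openin ?Z ?N"
        by (rule openin_continuous_map_preimage[where Y = euclideanreal])
          (auto intro!: continuous_map_diff continuous_map_real_mult \<rho>_cont[OF j] \<delta>_cont')
      show "topspace ?Z \<subseteq> ?D \<union> ?N"
      proof
        fix z assume z: "z \<in> topspace ?Z"
        then have "0 < \<delta> (fst z)" using \<delta>_pos by auto
        then show "z \<in> ?D \<union> ?N" using z by auto
      qed
      show "\<forall>(w, a)\<in>?D. \<forall>t\<in>{0..1}. \<bar>t - a\<bar> \<le> \<delta> w \<longrightarrow> 0 < \<phi> j (F (w, t))"
        using \<rho>_le[OF j] by fastforce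
      show "\<forall>z\<in>?N. \<gamma> j z = 0" by (auto simp: \<gamma>_def g_def)
    qed
  qed (use \<delta>_cont \<delta>_pos in auto)
qed

section \<open>Transport along a short path as a composite of chart steps\<close>

text \<open>\<open>\<tau> j\<close> is meaningful only inside the chart \<open>j\<close>. The case
  distinction makes a step that stays in its fibre the identity even outside the chart; inside, both
  branches agree by \<open>\<tau>_refl\<close>.\<close>

definition transport_step :: "'j \<Rightarrow> 'b \<Rightarrow> 'e \<Rightarrow> 'e" where
  "transport_step j c e = (if p e = c then e else \<tau> j c e)"

text \<open>The chart \<open>j\<close> transports along \<open>\<kappa>\<close> from time \<open>x\<close> to time \<open>x + \<gamma> j\<close>; weights adding up to one
  carry the lift all the way from \<open>\<kappa> 0\<close> to \<open>\<kappa> 1\<close>, and indices of weight zero have no effect.\<close>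

primrec transport_fold :: "(real \<Rightarrow> 'b) \<Rightarrow> ('j \<Rightarrow> real) \<Rightarrow> real \<Rightarrow> 'j list \<Rightarrow> 'e \<Rightarrow> 'e" where
  "transport_fold \<kappa> \<gamma> x [] e = e"
| "transport_fold \<kappa> \<gamma> x (j # js) e =
    transport_fold \<kappa> \<gamma> (x + \<gamma> j) js (transport_step j (\<kappa> (x + \<gamma> j)) e)"

text \<open>Only indices of nonzero weight must have the whole path in their chart. Lists may
  therefore contain inactive indices, as they must if one list is to serve a whole neighbourhood.
  The bound on \<open>x\<close> plus the sum of the weights keeps all intermediate times in the unit
  interval.\<close>

definition admissible :: "(real \<Rightarrow> 'b) \<Rightarrow> ('j \<Rightarrow> real) \<Rightarrow> real \<Rightarrow> 'j list \<Rightarrow> bool" where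
  "admissible \<kappa> \<gamma> x js \<longleftrightarrow> set js \<subseteq> J \<and> (\<forall>t\<in>{0..1}. \<kappa> t \<in> topspace B) \<and>
    (\<forall>j\<in>set js. 0 \<le> \<gamma> j \<and> (\<gamma> j \<noteq> 0 \<longrightarrow> (\<forall>t\<in>{0..1}. 0 < \<phi> j (\<kappa> t)))) \<and>
    0 \<le> x \<and> x + sum_list (map \<gamma> js) \<le> 1"

lemma admissible_Cons:
  assumes "admissible \<kappa> \<gamma> x (j # js)"
  shows "admissible \<kappa> \<gamma> (x + \<gamma> j) js" "x \<in> {0..1}" "x + \<gamma> j \<in> {0..1}"
proof -
  have "0 \<le> sum_list (map \<gamma> js)"
    using assms by (intro sum_list_nonneg) (auto simp: admissible_def)
  then show "admissible \<kappa> \<gamma> (x + \<gamma> j) js" "x \<in> {0..1}" "x + \<gamma> j \<in> {0..1}"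
    using assms by (auto simp: admissible_def add.assoc)
qed

lemma transport_step_over:
  assumes adm: "admissible \<kappa> \<gamma> x (j # js)" and e: "e \<in> topspace E" "p e = \<kappa> x"
  shows "transport_step j (\<kappa> (x + \<gamma> j)) e \<in> topspace E"
    and "p (transport_step j (\<kappa> (x + \<gamma> j)) e) = \<kappa> (x + \<gamma> j)"
    and "\<sigma> \<in> S \<Longrightarrow> transport_step j (\<kappa> (x + \<gamma> j)) (\<sigma> e) = \<sigma> (transport_step j (\<kappa> (x + \<gamma> j)) e)"
proof -
  note x = admissible_Cons(2,3)[OF adm]
  have j: "j \<in> J" using adm by (simp add: admissible_def)
  have \<kappa>: "\<kappa> (x + \<gamma> j) \<in> topspace B" using adm x(2) by (simp add: admissible_def)
  \<comment> \<open>A step that changes the fibre has nonzero weight, so admissibility puts both of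
    its ends in the chart; any other step is the identity.\<close>
  have pos: "0 < \<phi> j (\<kappa> (x + \<gamma> j))" "0 < \<phi> j (p e)" if "p e \<noteq> \<kappa> (x + \<gamma> j)"
  proof -
    have "\<gamma> j \<noteq> 0" using that e(2) by auto
    then show "0 < \<phi> j (\<kappa> (x + \<gamma> j))" "0 < \<phi> j (p e)" using adm x e(2) by (simp_all add: admissible_def)
  qed
  show "transport_step j (\<kappa> (x + \<gamma> j)) e \<in> topspace E"
    using e pos j \<kappa> \<tau>_topspace by (simp add: transport_step_def)
  show "p (transport_step j (\<kappa> (x + \<gamma> j)) e) = \<kappa> (x + \<gamma> j)"
    using e pos j \<kappa> \<tau>_over by (simp add: transport_step_def)
  show "transport_step j (\<kappa> (x + \<gamma> j)) (\<sigma> e) = \<sigma> (transport_step j (\<kappa> (x + \<gamma> j)) e)" if "\<sigma> \<in> S"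
    using e pos j \<kappa> \<tau>_equivariant S_fibrewise that by (simp add: transport_step_def)
qed

lemma transport_fold_over:
  assumes "admissible \<kappa> \<gamma> x js" "e \<in> topspace E" "p e = \<kappa> x"
  shows "transport_fold \<kappa> \<gamma> x js e \<in> topspace E \<and>
    p (transport_fold \<kappa> \<gamma> x js e) = \<kappa> (x + sum_list (map \<gamma> js))"
  using assms
proof (induction js arbitrary: x e)
  case (Cons j js)
  show ?case
    using Cons.IH[OF admissible_Cons(1)[OF Cons.prems(1)] transport_step_over(1,2)[OF Cons.prems]]
    by (simp add: add.assoc)
qed simp

lemma transport_fold_equivariant:
  assumes "admissible \<kappa> \<gamma> x js" "e \<in> topspace E" "p e = \<kappa> x" "\<sigma> \<in> S"
  shows "transport_fold \<kappa> \<gamma> x js (\<sigma> e) = \<sigma> (transport_fold \<kappa> \<gamma> x js e)"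
  using assms(1-3)
proof (induction js arbitrary: x e)
  case (Cons j js)
  show ?case
    using Cons.IH[OF admissible_Cons(1)[OF Cons.prems(1)] transport_step_over(1,2)[OF Cons.prems]]
      transport_step_over(3)[OF Cons.prems assms(4)]
    by simp
qed simp

text \<open>An index of weight zero leaves the time unchanged, so its target fibre already contains
  the current point and its step is the identity.\<close>

lemma transport_fold_filter:
  assumes "admissible \<kappa> \<gamma> x js" "e \<in> topspace E" "p e = \<kappa> x"
  shows "transport_fold \<kappa> \<gamma> x (filter (\<lambda>j. \<gamma> j \<noteq> 0) js) e = transport_fold \<kappa> \<gamma> x js e"
  using assms
proof (induction js arbitrary: x e)
  case (Cons j js)
  show ?case
    using Cons.IH[OF admissible_Cons(1)[OF Cons.prems(1)] transport_step_over(1,2)[OF Cons.prems]] Cons.prems(3)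
    by (auto simp: transport_step_def)
qed simp

text \<open>This is why the iterated lift stops moving once the path has been used up.\<close>

lemma transport_fold_const:
  assumes "admissible \<kappa> \<gamma> x js" "\<And>t. t \<in> {0..1} \<Longrightarrow> \<kappa> t = p e"
  shows "transport_fold \<kappa> \<gamma> x js e = e"
  using assms(1)
proof (induction js arbitrary: x)
  case (Cons j js)
  show ?case
    using Cons.IH[OF admissible_Cons(1)[OF Cons.prems]] assms(2)[OF admissible_Cons(3)[OF Cons.prems]]
    by (simp add: transport_step_def)
qed simp

text \<open>The locus where the case distinction takes its first branch need not be open.
  Overlapping open sets replace it: on \<open>D\<close> both branches are given by
  \<open>\<tau> j\<close>, and on \<open>N\<close> the step is the identity.\<close>

lemma continuous_map_transport_step:
  assumes j: "j \<in> J" and c: "continuous_map Y B c" and \<epsilon>: "continuous_map Y E \<epsilon>"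
    and D: "openin Y D" "\<And>y. y \<in> D \<Longrightarrow> 0 < \<phi> j (c y) \<and> 0 < \<phi> j (p (\<epsilon> y))"
    and N: "openin Y N" "\<And>y. y \<in> N \<Longrightarrow> p (\<epsilon> y) = c y"
    and DN: "topspace Y \<subseteq> D \<union> N"
  shows "continuous_map Y E (\<lambda>y. transport_step j (c y) (\<epsilon> y))"
proof (rule continuous_map_local)
  fix y assume "y \<in> topspace Y"
  then consider "y \<in> D" | "y \<in> N" using DN by blast
  then show "\<exists>V f'. openin Y V \<and> y \<in> V \<and> continuous_map (subtopology Y V) E f' \<and>
      (\<forall>v\<in>V. transport_step j (c v) (\<epsilon> v) = f' v)"
  proof cases
    case 1
    have "continuous_map (subtopology Y D) (prod_topology B E) (\<lambda>y. (c y, \<epsilon> y))"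
      by (intro continuous_map_pairedI continuous_map_from_subtopology c \<epsilon>)
    then have "continuous_map (subtopology Y D)
        (subtopology (prod_topology B E) {(c, e). 0 < \<phi> j c \<and> 0 < \<phi> j (p e)}) (\<lambda>y. (c y, \<epsilon> y))"
      using D(2) by (intro continuous_map_into_subtopology) auto
    from continuous_map_compose[OF this \<tau>_cont[OF j]]
    have "continuous_map (subtopology Y D) E (\<lambda>y. \<tau> j (c y) (\<epsilon> y))" by (simp add: o_def)
    moreover have "transport_step j (c v) (\<epsilon> v) = \<tau> j (c v) (\<epsilon> v)" if "v \<in> D" for v
    proof -
      have "\<epsilon> v \<in> topspace E"
        using that openin_subset[OF D(1)] continuous_map_image_subset_topspace[OF \<epsilon>] by blast
      then show ?thesis using \<tau>_refl[OF j, of "\<epsilon> v"] D(2)[OF that] by (auto simp: transport_step_def)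
    qed
    ultimately show ?thesis using D(1) 1 by blast
  next
    case 2
    have "continuous_map (subtopology Y N) E \<epsilon>" by (rule continuous_map_from_subtopology[OF \<epsilon>])
    moreover have "transport_step j (c v) (\<epsilon> v) = \<epsilon> v" if "v \<in> N" for v
      using N(2)[OF that] by (simp add: transport_step_def)
    ultimately show ?thesis using N(1) 2 by blast
  qed
qed

text \<open>With the list fixed, only the weights vary and continuity follows step by step. Start
  time \<open>\<xi>\<close> and start point \<open>\<epsilon>\<close> are arbitrary functions of
  \<open>y\<close> because the recursion changes both.\<close>

lemma continuous_map_transport_fold:
  assumes K: "continuous_map (prod_topology Y unit_I) B K"
    and js: "set js \<subseteq> J"
    and \<gamma>: "\<And>j. j \<in> set js \<Longrightarrow> continuous_map Y euclideanreal (\<lambda>y. \<gamma> y j)"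
    and DN: "\<And>j. j \<in> set js \<Longrightarrow> \<exists>D N. openin Y D \<and> openin Y N \<and> topspace Y \<subseteq> D \<union> N \<and>
      (\<forall>y\<in>D. \<forall>t\<in>{0..1}. 0 < \<phi> j (K (y, t))) \<and> (\<forall>y\<in>N. \<gamma> y j = 0)"
    and adm: "\<And>y. y \<in> topspace Y \<Longrightarrow> admissible (\<lambda>t. K (y, t)) (\<gamma> y) (\<xi> y) js"
    and \<xi>: "continuous_map Y euclideanreal \<xi>"
    and \<epsilon>: "continuous_map Y E \<epsilon>" "\<And>y. y \<in> topspace Y \<Longrightarrow> p (\<epsilon> y) = K (y, \<xi> y)"
  shows "continuous_map Y E (\<lambda>y. transport_fold (\<lambda>t. K (y, t)) (\<gamma> y) (\<xi> y) js (\<epsilon> y))"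
  using js \<gamma> DN adm \<xi> \<epsilon>
proof (induction js arbitrary: \<xi> \<epsilon>)
  case (Cons j js)
  let ?\<xi> = "\<lambda>y. \<xi> y + \<gamma> y j"
  let ?\<epsilon> = "\<lambda>y. transport_step j (K (y, ?\<xi> y)) (\<epsilon> y)"
  have \<epsilon>t: "\<epsilon> y \<in> topspace E" if "y \<in> topspace Y" for y
    using continuous_map_image_subset_topspace[OF Cons.prems(6)] that by blast
  have \<xi>c: "continuous_map Y euclideanreal ?\<xi>"
    using Cons.prems(2,5) by (intro continuous_map_add) auto
  have "?\<xi> \<in> topspace Y \<rightarrow> {0..1}" using admissible_Cons(3)[OF Cons.prems(4)] by blast
  then have "continuous_map Y unit_I ?\<xi>" using \<xi>c by (simp add: continuous_map_in_subtopology image_subset_iff_funcset)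
  then have "continuous_map Y (prod_topology Y unit_I) (\<lambda>y. (y, ?\<xi> y))"
    by (intro continuous_map_pairedI) auto
  from continuous_map_compose[OF this K] have c: "continuous_map Y B (\<lambda>y. K (y, ?\<xi> y))"
    by (simp add: o_def)
  obtain D N where D: "openin Y D" "openin Y N" "topspace Y \<subseteq> D \<union> N"
    "\<forall>y\<in>D. \<forall>t\<in>{0..1}. 0 < \<phi> j (K (y, t))" "\<forall>y\<in>N. \<gamma> y j = 0"
    using Cons.prems(3)[of j] by auto
  have j: "j \<in> J" using Cons.prems(1) by simp
  have "continuous_map Y E ?\<epsilon>"
  proof (rule continuous_map_transport_step[OF j c Cons.prems(6) D(1) _ D(2) _ D(3)])
    show "0 < \<phi> j (K (y, ?\<xi> y)) \<and> 0 < \<phi> j (p (\<epsilon> y))" if "y \<in> D" for y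
    proof -
      have y: "y \<in> topspace Y" using that openin_subset[OF D(1)] by blast
      show ?thesis
        using D(4) that admissible_Cons(2,3)[OF Cons.prems(4)[OF y]] Cons.prems(7)[OF y] by simp
    qed
    show "p (\<epsilon> y) = K (y, ?\<xi> y)" if "y \<in> N" for y
      using that openin_subset[OF D(2)] D(5) Cons.prems(7) by auto
  qed
  then show ?case
    using Cons.prems admissible_Cons(1)[OF Cons.prems(4)] transport_step_over(2)[OF Cons.prems(4) \<epsilon>t Cons.prems(7)] \<xi>c
    by simp (intro Cons.IH; simp)
qed simp

text \<open>The list of active indices jumps with \<open>y\<close>. Near a given point all active
  indices lie in one finite set \<open>A\<close>; coherence of \<open>L\<close> and the removal of
  zero weights turn the fold into one over the fixed list \<open>L A\<close>.\<close>

lemma continuous_map_short_lift: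
  assumes L: "\<And>A. finite A \<Longrightarrow> set (L A) = A \<and> distinct (L A)"
      "\<And>A P. finite A \<Longrightarrow> L {a\<in>A. P a} = filter P (L A)"
    and K: "continuous_map (prod_topology Y unit_I) B K"
    and \<gamma>: "\<And>j. j \<in> J \<Longrightarrow> continuous_map Y euclideanreal (\<lambda>y. \<gamma> y j)"
      "\<And>j y. j \<in> J \<Longrightarrow> y \<in> topspace Y \<Longrightarrow> 0 \<le> \<gamma> y j"
      "\<And>y. y \<in> topspace Y \<Longrightarrow> \<exists>V. openin Y V \<and> y \<in> V \<and> finite {j\<in>J. \<exists>v\<in>V. \<gamma> v j \<noteq> 0}"
      "\<And>y. y \<in> topspace Y \<Longrightarrow> (\<Sum>j\<in>{j\<in>J. \<gamma> y j \<noteq> 0}. \<gamma> y j) = 1"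
    and DN: "\<And>j. j \<in> J \<Longrightarrow> \<exists>D N. openin Y D \<and> openin Y N \<and> topspace Y \<subseteq> D \<union> N \<and>
      (\<forall>y\<in>D. \<forall>t\<in>{0..1}. 0 < \<phi> j (K (y, t))) \<and> (\<forall>y\<in>N. \<gamma> y j = 0)"
    and \<epsilon>: "continuous_map Y E \<epsilon>" "\<And>y. y \<in> topspace Y \<Longrightarrow> p (\<epsilon> y) = K (y, 0)"
  shows "continuous_map Y E (\<lambda>y. transport_fold (\<lambda>t. K (y, t)) (\<gamma> y) 0 (L {j\<in>J. \<gamma> y j \<noteq> 0}) (\<epsilon> y))"
    and "\<And>y. y \<in> topspace Y \<Longrightarrow> admissible (\<lambda>t. K (y, t)) (\<gamma> y) 0 (L {j\<in>J. \<gamma> y j \<noteq> 0})"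
    and "\<And>y. y \<in> topspace Y \<Longrightarrow> sum_list (map (\<gamma> y) (L {j\<in>J. \<gamma> y j \<noteq> 0})) = 1"
proof -
  have pos: "0 < \<phi> j (K (y, t))" if "j \<in> J" "y \<in> topspace Y" "\<gamma> y j \<noteq> 0" "t \<in> {0..1}" for j y t
    using DN[OF that(1)] that(2-) by blast
  have Kt: "K (y, t) \<in> topspace B" if "y \<in> topspace Y" "t \<in> {0..1}" for y t
    using continuous_map_image_subset_topspace[OF K] that by (auto simp: image_subset_iff)
  have sums: "sum_list (map (\<gamma> y) (L A)) = 1"
    if "finite A" "A \<subseteq> J" "{j\<in>J. \<gamma> y j \<noteq> 0} \<subseteq> A" "y \<in> topspace Y" for A y
  proof -
    have "sum_list (map (\<gamma> y) (L A)) = (\<Sum>j\<in>A. \<gamma> y j)"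
      using L(1)[OF that(1)] by (simp add: sum_list_distinct_conv_sum_set)
    also have "\<dots> = (\<Sum>j\<in>{j\<in>J. \<gamma> y j \<noteq> 0}. \<gamma> y j)"
      using that by (intro sum.mono_neutral_right) auto
    finally show ?thesis using \<gamma>(4)[OF that(4)] by simp
  qed
  have adm: "admissible (\<lambda>t. K (y, t)) (\<gamma> y) 0 (L A)"
    if "finite A" "A \<subseteq> J" "{j\<in>J. \<gamma> y j \<noteq> 0} \<subseteq> A" "y \<in> topspace Y" for A y
    unfolding admissible_def
    using sums[OF that] L(1)[OF that(1)] that Kt pos \<gamma>(2) by auto
  have fin: "finite {j\<in>J. \<gamma> y j \<noteq> 0}" if y: "y \<in> topspace Y" for y
  proof -
    obtain V where "y \<in> V" "finite {j\<in>J. \<exists>v\<in>V. \<gamma> v j \<noteq> 0}" using \<gamma>(3)[OF y] by blast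
    then show ?thesis by (auto elim!: rev_finite_subset)
  qed
  show "admissible (\<lambda>t. K (y, t)) (\<gamma> y) 0 (L {j\<in>J. \<gamma> y j \<noteq> 0})" if "y \<in> topspace Y" for y
    by (rule adm[OF fin[OF that] _ _ that]) auto
  show "sum_list (map (\<gamma> y) (L {j\<in>J. \<gamma> y j \<noteq> 0})) = 1" if "y \<in> topspace Y" for y
    by (rule sums[OF fin[OF that] _ _ that]) auto
  show "continuous_map Y E (\<lambda>y. transport_fold (\<lambda>t. K (y, t)) (\<gamma> y) 0 (L {j\<in>J. \<gamma> y j \<noteq> 0}) (\<epsilon> y))"
  proof (rule continuous_map_local)
    fix y assume y: "y \<in> topspace Y"
    obtain V where V: "openin Y V" "y \<in> V" "finite {j\<in>J. \<exists>v\<in>V. \<gamma> v j \<noteq> 0}" using \<gamma>(3)[OF y] by blast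
    define A where "A = {j\<in>J. \<exists>v\<in>V. \<gamma> v j \<noteq> 0}"
    have A: "finite A" "A \<subseteq> J" "set (L A) = A" using V(3) L(1) by (auto simp: A_def)
    have VY: "V \<subseteq> topspace Y" using openin_subset[OF V(1)] .
    have sub: "{j\<in>J. \<gamma> v j \<noteq> 0} \<subseteq> A" if "v \<in> V" for v using that by (auto simp: A_def)
    let ?Y = "subtopology Y V"
    have tY: "topspace ?Y = V" using VY by auto
    have "continuous_map ?Y E (\<lambda>y. transport_fold (\<lambda>t. K (y, t)) (\<gamma> y) ((\<lambda>_. 0) y) (L A) (\<epsilon> y))"
    proof (rule continuous_map_transport_fold)
      show "set (L A) \<subseteq> J" using A by simp
      show "continuous_map (prod_topology ?Y unit_I) B K"
        unfolding prod_topology_subtopology(1) by (rule continuous_map_from_subtopology[OF K])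
      show "continuous_map ?Y euclideanreal (\<lambda>y. \<gamma> y j)" if "j \<in> set (L A)" for j
        using \<gamma>(1) that A by (intro continuous_map_from_subtopology) auto
      show "\<exists>D N. openin ?Y D \<and> openin ?Y N \<and> topspace ?Y \<subseteq> D \<union> N \<and>
        (\<forall>y\<in>D. \<forall>t\<in>{0..1}. 0 < \<phi> j (K (y, t))) \<and> (\<forall>y\<in>N. \<gamma> y j = 0)" if j: "j \<in> set (L A)" for j
      proof -
        obtain D N where D: "openin Y D" "openin Y N" "topspace Y \<subseteq> D \<union> N"
          "\<forall>y\<in>D. \<forall>t\<in>{0..1}. 0 < \<phi> j (K (y, t))" "\<forall>y\<in>N. \<gamma> y j = 0"
          using DN[of j] j A by blast
        have "openin ?Y (D \<inter> V)" "openin ?Y (N \<inter> V)" using D(1,2) by (auto simp: openin_subtopology)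
        then show ?thesis using D(3-5) by (intro exI[of _ "D \<inter> V"] exI[of _ "N \<inter> V"]) auto
      qed
      show "admissible (\<lambda>t. K (v, t)) (\<gamma> v) 0 (L A)" if "v \<in> topspace ?Y" for v
        using that tY VY by (intro adm[OF A(1,2) sub]) auto
      show "continuous_map ?Y E \<epsilon>" by (rule continuous_map_from_subtopology[OF \<epsilon>(1)])
    qed (use \<epsilon>(2) in auto)
    moreover have "transport_fold (\<lambda>t. K (v, t)) (\<gamma> v) 0 (L {j\<in>J. \<gamma> v j \<noteq> 0}) (\<epsilon> v) =
        transport_fold (\<lambda>t. K (v, t)) (\<gamma> v) 0 (L A) (\<epsilon> v)" if v: "v \<in> V" for v
    proof -
      have vY: "v \<in> topspace Y" using v VY by blast
      have "{j\<in>J. \<gamma> v j \<noteq> 0} = {j\<in>A. \<gamma> v j \<noteq> 0}" using v by (auto simp: A_def)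
      then have eq: "L {j\<in>J. \<gamma> v j \<noteq> 0} = filter (\<lambda>j. \<gamma> v j \<noteq> 0) (L A)"
        using L(2)[OF A(1)] by simp
      have "\<epsilon> v \<in> topspace E" using continuous_map_image_subset_topspace[OF \<epsilon>(1)] vY by blast
      then show ?thesis
        unfolding eq using transport_fold_filter[OF adm[OF A(1,2) sub[OF v] vY]] \<epsilon>(2)[OF vY] by blast
    qed
    ultimately show "\<exists>V f'. openin Y V \<and> y \<in> V \<and> continuous_map (subtopology Y V) E f' \<and>
        (\<forall>v\<in>V. transport_fold (\<lambda>t. K (v, t)) (\<gamma> v) 0 (L {j\<in>J. \<gamma> v j \<noteq> 0}) (\<epsilon> v) = f' v)"
      using V(1,2) by auto
  qed
qed

section \<open>Lifting whole paths by iterated short lifts\<close>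

text \<open>The path up to time \<open>t\<close> is cut into pieces of length at most
  \<open>\<delta> w\<close>, each lifted with the weights of its starting time. Pieces beyond
  \<open>t\<close> are degenerate and do nothing, so all sufficiently large numbers of iterations
  give the same lift, and near a given point one number serves.\<close>

theorem covering_homotopy:
  assumes F: "continuous_map (prod_topology W unit_I) B F"
  obtains \<Lambda> where
    "continuous_map (subtopology (prod_topology (prod_topology W unit_I) E) {((w, t), e). p e = F (w, 0)}) E
      (\<lambda>((w, t), e). \<Lambda> w t e)"
    "\<And>w t e. w \<in> topspace W \<Longrightarrow> t \<in> {0..1} \<Longrightarrow> e \<in> topspace E \<Longrightarrow> p e = F (w, 0) \<Longrightarrow> p (\<Lambda> w t e) = F (w, t)"
    "\<And>w e. w \<in> topspace W \<Longrightarrow> e \<in> topspace E \<Longrightarrow> p e = F (w, 0) \<Longrightarrow> \<Lambda> w 0 e = e"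
    "\<And>w t e \<sigma>. w \<in> topspace W \<Longrightarrow> t \<in> {0..1} \<Longrightarrow> e \<in> topspace E \<Longrightarrow> p e = F (w, 0) \<Longrightarrow> \<sigma> \<in> S \<Longrightarrow>
      \<Lambda> w t (\<sigma> e) = \<sigma> (\<Lambda> w t e)"
proof -
  let ?Z = "prod_topology W unit_I"
  obtain \<delta> \<gamma> where \<delta>: "continuous_map W euclideanreal \<delta>" "\<And>w. w \<in> topspace W \<Longrightarrow> 0 < \<delta> w"
    and \<gamma>: "\<And>j. j \<in> J \<Longrightarrow> continuous_map ?Z euclideanreal (\<gamma> j)"
      "\<And>j z. j \<in> J \<Longrightarrow> z \<in> topspace ?Z \<Longrightarrow> 0 \<le> \<gamma> j z"
      "\<And>z. z \<in> topspace ?Z \<Longrightarrow> \<exists>V. openin ?Z V \<and> z \<in> V \<and> finite {j\<in>J. \<exists>v\<in>V. \<gamma> j v \<noteq> 0}"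
      "\<And>z. z \<in> topspace ?Z \<Longrightarrow> (\<Sum>j\<in>{j\<in>J. \<gamma> j z \<noteq> 0}. \<gamma> j z) = 1"
    and DN: "\<And>j. j \<in> J \<Longrightarrow> \<exists>D N. openin ?Z D \<and> openin ?Z N \<and> topspace ?Z \<subseteq> D \<union> N \<and>
      (\<forall>(w, a)\<in>D. \<forall>t\<in>{0..1}. \<bar>t - a\<bar> \<le> \<delta> w \<longrightarrow> 0 < \<phi> j (F (w, t))) \<and> (\<forall>z\<in>N. \<gamma> j z = 0)"
    by (rule step_size[OF F]) (rule that)
  obtain L :: "'j set \<Rightarrow> 'j list" where L: "\<And>A. finite A \<Longrightarrow> set (L A) = A \<and> distinct (L A)"
      "\<And>A P. finite A \<Longrightarrow> L {a\<in>A. P a} = filter P (L A)"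
    using coherent_enumerations by blast
  \<comment> \<open>The space of all lifting problems. Having the initial point among the parameters
    yields continuity in \<open>w\<close>, \<open>t\<close> and \<open>e\<close> jointly.\<close>
  define Y where "Y = subtopology (prod_topology ?Z E) {((w, t), e). p e = F (w, 0)}"
  have tY: "y \<in> topspace Y \<longleftrightarrow> fst (fst y) \<in> topspace W \<and> snd (fst y) \<in> {0..1} \<and> snd y \<in> topspace E \<and>
      p (snd y) = F (fst (fst y), 0)" for y
    by (cases y) (auto simp: Y_def)
  have cZ: "continuous_map Y ?Z fst"
    unfolding Y_def by (intro continuous_map_from_subtopology continuous_map_fst)
  have cw: "continuous_map Y W (\<lambda>y. fst (fst y))"
    using continuous_map_compose[OF cZ continuous_map_fst] by (simp add: o_def)
  have ct: "continuous_map Y euclideanreal (\<lambda>y. snd (fst y))"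
    using continuous_map_compose[OF cZ continuous_map_snd] by (simp add: o_def continuous_map_in_subtopology)
  have ce: "continuous_map Y E snd"
    unfolding Y_def by (intro continuous_map_from_subtopology continuous_map_snd)
  have c\<delta>: "continuous_map Y euclideanreal (\<lambda>y. \<delta> (fst (fst y)))"
    using continuous_map_compose[OF cw \<delta>(1)] by (simp add: o_def)
  \<comment> \<open>Division points, capped at \<open>t\<close>. Below, \<open>s n y\<close> runs
    affinely through the \<open>n\<close>-th piece, and the weights \<open>\<Gamma> n\<close> are
    taken at its left end: a chart of nonzero weight there contains the path within distance
    \<open>\<delta> w\<close>, hence on the whole piece.\<close>
  define a where "a n = (\<lambda>y::('a \<times> real) \<times> 'e. min (snd (fst y)) (real n * \<delta> (fst (fst y))))" for n :: nat
  define s where "s n = (\<lambda>y x. a n y + (a (Suc n) y - a n y) * x)" for n :: nat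
  define K where "K n = (\<lambda>(y, x). F (fst (fst y), s n y x))" for n :: nat
  define \<Gamma> where "\<Gamma> n y j = \<gamma> j (fst (fst y), a n y)" for n y j
  have ca: "continuous_map Y euclideanreal (a n)" for n
    unfolding a_def by (intro continuous_map_real_min ct continuous_map_real_mult c\<delta>) auto
  have a01: "a n y \<in> {0..1}" if "y \<in> topspace Y" for n y
    using that \<delta>(2) by (auto simp: tY a_def min_def less_imp_le)
  have aS: "a n y \<le> a (Suc n) y" "a (Suc n) y - a n y \<le> \<delta> (fst (fst y))" if "y \<in> topspace Y" for n y
  proof -
    have "0 < \<delta> (fst (fst y))" using that \<delta>(2) tY by blast
    then show "a n y \<le> a (Suc n) y" "a (Suc n) y - a n y \<le> \<delta> (fst (fst y))"
      by (auto simp: a_def min_def algebra_simps)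
  qed
  have s: "s n y x \<in> {0..1}" "\<bar>s n y x - a n y\<bar> \<le> \<delta> (fst (fst y))" if "y \<in> topspace Y" "x \<in> {0..1}" for n y x
  proof -
    have 0: "0 \<le> (a (Suc n) y - a n y) * x" "(a (Suc n) y - a n y) * x \<le> a (Suc n) y - a n y"
      using aS(1)[OF that(1), of n] that(2) by (auto intro: mult_left_le)
    show "s n y x \<in> {0..1}"
      using 0 a01[OF that(1), of n] a01[OF that(1), of "Suc n"] unfolding s_def by auto
    show "\<bar>s n y x - a n y\<bar> \<le> \<delta> (fst (fst y))"
      using 0 aS(2)[OF that(1), of n] unfolding s_def by auto
  qed
  have cza: "continuous_map Y ?Z (\<lambda>y. (fst (fst y), a n y))" for n
    using a01 by (intro continuous_map_pairedI cw continuous_map_into_subtopology ca) auto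
  have cK: "continuous_map (prod_topology Y unit_I) B (K n)" for n
  proof -
    let ?P = "prod_topology Y unit_I"
    have 1: "continuous_map ?P W (\<lambda>z. fst (fst (fst z)))"
      using continuous_map_compose[OF continuous_map_fst cw] by (simp add: o_def)
    have 2: "continuous_map ?P euclideanreal (\<lambda>z. a n (fst z))" for n
      using continuous_map_compose[OF continuous_map_fst ca] by (simp add: o_def)
    have 3: "continuous_map ?P euclideanreal snd"
      using continuous_map_snd[of Y unit_I] by (simp add: continuous_map_in_subtopology)
    have "continuous_map ?P unit_I (\<lambda>z. s n (fst z) (snd z))"
    proof (rule continuous_map_into_subtopology)
      show "continuous_map ?P euclideanreal (\<lambda>z. s n (fst z) (snd z))"
        unfolding s_def by (intro continuous_map_add continuous_map_real_mult continuous_map_diff 2 3)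
      show "(\<lambda>z. s n (fst z) (snd z)) \<in> topspace ?P \<rightarrow> {0..1}" using s(1) by fastforce
    qed
    then have "continuous_map ?P ?Z (\<lambda>z. (fst (fst (fst z)), s n (fst z) (snd z)))"
      by (intro continuous_map_pairedI 1)
    from continuous_map_compose[OF this F] show ?thesis by (simp add: K_def o_def case_prod_unfold)
  qed
  have \<Gamma>: "continuous_map Y euclideanreal (\<lambda>y. \<Gamma> n y j)" if "j \<in> J" for n j
    using continuous_map_compose[OF cza \<gamma>(1)[OF that]] by (simp add: \<Gamma>_def o_def)
  have za: "(fst (fst y), a n y) \<in> topspace ?Z" if "y \<in> topspace Y" for n y
    using that a01 tY by simp
  have \<Gamma>0: "0 \<le> \<Gamma> n y j" if "j \<in> J" "y \<in> topspace Y" for n j y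
    unfolding \<Gamma>_def by (rule \<gamma>(2)[OF that(1) za[OF that(2)]])
  have \<Gamma>1: "(\<Sum>j\<in>{j\<in>J. \<Gamma> n y j \<noteq> 0}. \<Gamma> n y j) = 1" if "y \<in> topspace Y" for n y
    unfolding \<Gamma>_def by (rule \<gamma>(4)[OF za[OF that]])
  have \<Gamma>lf: "\<exists>V. openin Y V \<and> y \<in> V \<and> finite {j\<in>J. \<exists>v\<in>V. \<Gamma> n v j \<noteq> 0}" if y: "y \<in> topspace Y" for n y
  proof -
    obtain V where V: "openin ?Z V" "(fst (fst y), a n y) \<in> V" "finite {j\<in>J. \<exists>v\<in>V. \<gamma> j v \<noteq> 0}"
      using \<gamma>(3)[OF za[OF y]] by blast
    let ?V = "{y \<in> topspace Y. (fst (fst y), a n y) \<in> V}"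
    have "openin Y ?V" by (rule openin_continuous_map_preimage[OF cza V(1)])
    moreover have "{j\<in>J. \<exists>v\<in>?V. \<Gamma> n v j \<noteq> 0} \<subseteq> {j\<in>J. \<exists>v\<in>V. \<gamma> j v \<noteq> 0}" by (auto simp: \<Gamma>_def)
    ultimately show ?thesis using V y by (intro exI[of _ ?V]) (auto intro: finite_subset)
  qed
  have \<Gamma>DN: "\<exists>D N. openin Y D \<and> openin Y N \<and> topspace Y \<subseteq> D \<union> N \<and>
      (\<forall>y\<in>D. \<forall>t\<in>{0..1}. 0 < \<phi> j (K n (y, t))) \<and> (\<forall>y\<in>N. \<Gamma> n y j = 0)" if j: "j \<in> J" for n j
  proof -
    obtain D N where D: "openin ?Z D" "openin ?Z N" "topspace ?Z \<subseteq> D \<union> N"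
      "\<forall>(w, a)\<in>D. \<forall>t\<in>{0..1}. \<bar>t - a\<bar> \<le> \<delta> w \<longrightarrow> 0 < \<phi> j (F (w, t))" "\<forall>z\<in>N. \<gamma> j z = 0"
      using DN[OF j] by blast
    let ?D = "{y \<in> topspace Y. (fst (fst y), a n y) \<in> D}" and ?N = "{y \<in> topspace Y. (fst (fst y), a n y) \<in> N}"
    have "openin Y ?D" "openin Y ?N" by (rule openin_continuous_map_preimage[OF cza], fact)+
    moreover have "topspace Y \<subseteq> ?D \<union> ?N" using za D(3) by blast
    moreover have "0 < \<phi> j (K n (y, t))" if "y \<in> ?D" "t \<in> {0..1}" for y t
      using that s[of y t n] D(4) by (auto simp: K_def)
    ultimately show ?thesis using D(5) by (intro exI[of _ ?D] exI[of _ ?N]) (auto simp: \<Gamma>_def)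
  qed
  have K0: "K n (y, 0) = F (fst (fst y), a n y)" and K1: "K n (y, 1) = F (fst (fst y), a (Suc n) y)" for n y
    by (auto simp: K_def s_def)
  define step where "step n y e = transport_fold (\<lambda>t. K n (y, t)) (\<Gamma> n y) 0 (L {j\<in>J. \<Gamma> n y j \<noteq> 0}) e" for n y e
  have short: "continuous_map Y E (\<lambda>y. step n y (\<epsilon> y))"
      "\<And>y. y \<in> topspace Y \<Longrightarrow> admissible (\<lambda>t. K n (y, t)) (\<Gamma> n y) 0 (L {j\<in>J. \<Gamma> n y j \<noteq> 0})"
      "\<And>y. y \<in> topspace Y \<Longrightarrow> sum_list (map (\<Gamma> n y) (L {j\<in>J. \<Gamma> n y j \<noteq> 0})) = 1"
    if "continuous_map Y E \<epsilon>" "\<And>y. y \<in> topspace Y \<Longrightarrow> p (\<epsilon> y) = K n (y, 0)" for n \<epsilon>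
    unfolding step_def
    by (rule continuous_map_short_lift[OF L cK \<Gamma> \<Gamma>0 \<Gamma>lf \<Gamma>1 \<Gamma>DN that]; assumption)+
  define iter where "iter n y = rec_nat (snd y) (\<lambda>n e. step n y e) n" for n y
  have iter0: "iter 0 y = snd y" and iterS: "iter (Suc n) y = step n y (iter n y)" for n y
    by (simp_all add: iter_def)
  have main: "continuous_map Y E (iter n) \<and> (\<forall>y\<in>topspace Y. p (iter n y) = F (fst (fst y), a n y))" for n
  proof (induction n)
    case 0
    have "iter 0 = snd" by (rule ext) (rule iter0)
    moreover have "a 0 y = 0" if "y \<in> topspace Y" for y using that by (simp add: tY a_def)
    ultimately show ?case using ce tY by simp
  next
    case (Suc n)
    then have IH: "continuous_map Y E (iter n)" "\<And>y. y \<in> topspace Y \<Longrightarrow> p (iter n y) = K n (y, 0)"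
      by (auto simp: K0)
    have "continuous_map Y E (iter (Suc n))"
      unfolding iterS by (rule short(1)[OF IH])
    moreover have "p (iter (Suc n) y) = F (fst (fst y), a (Suc n) y)" if y: "y \<in> topspace Y" for y
    proof -
      have "iter n y \<in> topspace E" using continuous_map_image_subset_topspace[OF IH(1)] y by blast
      then have "p (iter (Suc n) y) = K n (y, 0 + sum_list (map (\<Gamma> n y) (L {j\<in>J. \<Gamma> n y j \<noteq> 0})))"
        unfolding iterS step_def using transport_fold_over[OF short(2)[OF IH y] _ IH(2)[OF y]] by blast
      then show ?thesis using short(3)[OF IH y] by (simp add: K1)
    qed
    ultimately show ?case by blast
  qed
  have itE: "iter n y \<in> topspace E" if "y \<in> topspace Y" for n y
    using continuous_map_image_subset_topspace[OF conjunct1[OF main]] that by blast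
  have itp: "p (iter n y) = K n (y, 0)" if "y \<in> topspace Y" for n y
    using main that by (simp add: K0)
  note adm = short(2)[OF conjunct1[OF main] itp]
  have equiv: "iter n (fst y, \<sigma> (snd y)) = \<sigma> (iter n y)" if y: "y \<in> topspace Y" and \<sigma>: "\<sigma> \<in> S" for n y \<sigma>
  proof (induction n)
    case (Suc n)
    \<comment> \<open>A step sees only \<open>w\<close> and \<open>t\<close>, so moving the initial
      point by \<open>\<sigma>\<close> changes neither the path nor the weights.\<close>
    have "step n (fst y, e) e' = step n y e'" for e e' by (auto simp: step_def K_def \<Gamma>_def[abs_def] s_def a_def)
    then show ?case
      using Suc transport_fold_equivariant[OF adm[OF _ y] itE[OF y] itp[OF y] \<sigma>, of n]
      by (simp add: iterS) (simp add: step_def)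
  qed (simp add: iter0)
  \<comment> \<open>Time \<open>t\<close> has been reached, so the \<open>n\<close>-th piece is a
    constant path.\<close>
  have const: "iter (Suc n) y = iter n y" if y: "y \<in> topspace Y" and n: "snd (fst y) \<le> real n * \<delta> (fst (fst y))" for n y
  proof -
    have "0 < \<delta> (fst (fst y))" using y \<delta>(2) tY by blast
    then have "a n y = snd (fst y)" "a (Suc n) y = snd (fst y)" using n by (auto simp: a_def min_def algebra_simps)
    then have "K n (y, x) = p (iter n y)" for x using itp[OF y] by (simp add: K0) (simp add: K_def s_def)
    then show ?thesis
      unfolding iterS step_def by (intro transport_fold_const adm[OF _ y]) auto
  qed
  have stable: "iter m y = iter n y"
    if y: "y \<in> topspace Y" and n: "snd (fst y) \<le> real n * \<delta> (fst (fst y))" and "n \<le> m" for n m y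
    using \<open>n \<le> m\<close>
  proof (induction m rule: dec_induct)
    case (step m)
    have "0 < \<delta> (fst (fst y))" using y \<delta>(2) tY by blast
    then have "real n * \<delta> (fst (fst y)) \<le> real m * \<delta> (fst (fst y))" using step(1) by simp
    then show ?case using const[OF y, of m] n step by simp
  qed simp
  \<comment> \<open>Enough steps of length \<open>d\<close> to exhaust the unit interval.\<close>
  define N where "N d = nat \<lceil>1 / d\<rceil>" for d :: real
  have N: "1 \<le> real (N d) * d" if "0 < d" for d
  proof -
    have "1 / d \<le> real (N d)" unfolding N_def by linarith
    then show ?thesis using that by (simp add: field_simps)
  qed
  define \<Lambda> where "\<Lambda> w t e = iter (N (\<delta> w)) ((w, t), e)" for w t e
  have Nt: "snd (fst y) \<le> real (N (\<delta> (fst (fst y)))) * \<delta> (fst (fst y))" if "y \<in> topspace Y" for y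
    using N[of "\<delta> (fst (fst y))"] \<delta>(2) that tY by fastforce
  show thesis
  proof (rule that[of \<Lambda>])
    have "continuous_map Y E (\<lambda>y. iter (N (\<delta> (fst (fst y)))) y)"
    proof (rule continuous_map_local)
      fix y assume y: "y \<in> topspace Y"
      define d where "d = \<delta> (fst (fst y))"
      have d: "0 < d" using y \<delta>(2) tY by (auto simp: d_def)
      \<comment> \<open>The number \<open>N (\<delta> w)\<close> may jump with \<open>w\<close>, but
        where \<open>\<delta>\<close> exceeds \<open>d / 2\<close> it is at most
        \<open>N (d / 2)\<close>, and stability allows this fixed number of steps instead.\<close>
      let ?V = "{y \<in> topspace Y. \<delta> (fst (fst y)) \<in> {d / 2<..}}"
      have "openin Y ?V" by (rule openin_continuous_map_preimage[OF c\<delta>]) auto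
      moreover have "iter (N (\<delta> (fst (fst v)))) v = iter (N (d / 2)) v" if v: "v \<in> ?V" for v
      proof -
        have "1 / \<delta> (fst (fst v)) \<le> 1 / (d / 2)" using v d by (intro divide_left_mono) auto
        then have "N (\<delta> (fst (fst v))) \<le> N (d / 2)"
          unfolding N_def by (intro nat_mono ceiling_mono)
        moreover have vY: "v \<in> topspace Y" using v by blast
        ultimately show ?thesis using stable[OF vY Nt[OF vY]] by metis
      qed
      moreover have "continuous_map (subtopology Y ?V) E (iter (N (d / 2)))"
        using main by (intro continuous_map_from_subtopology) blast
      moreover have "y \<in> ?V" using y d by (auto simp: d_def)
      ultimately show "\<exists>V f'. openin Y V \<and> y \<in> V \<and> continuous_map (subtopology Y V) E f' \<and>
          (\<forall>v\<in>V. iter (N (\<delta> (fst (fst v)))) v = f' v)" by blast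
    qed
    then show "continuous_map (subtopology (prod_topology ?Z E) {((w, t), e). p e = F (w, 0)}) E
        (\<lambda>((w, t), e). \<Lambda> w t e)"
      unfolding Y_def[symmetric] by (simp add: \<Lambda>_def case_prod_unfold)
  next
    fix w and t :: real and e assume "w \<in> topspace W" "t \<in> {0..1}" "e \<in> topspace E" "p e = F (w, 0)"
    then have y: "((w, t), e) \<in> topspace Y" by (simp add: tY)
    have "a (N (\<delta> w)) ((w, t), e) = t" using Nt[OF y] by (simp add: a_def min_def)
    then show "p (\<Lambda> w t e) = F (w, t)" using main y by (simp add: \<Lambda>_def)
    show "\<Lambda> w t (\<sigma> e) = \<sigma> (\<Lambda> w t e)" if "\<sigma> \<in> S" for \<sigma>
      using equiv[OF y that] by (simp add: \<Lambda>_def)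
  next
    fix w e assume "w \<in> topspace W" "e \<in> topspace E" "p e = F (w, 0)"
    then have y: "((w, 0), e) \<in> topspace Y" by (simp add: tY)
    show "\<Lambda> w 0 e = e" using stable[OF y, of 0 "N (\<delta> w)"] by (simp add: \<Lambda>_def iter0)
  qed
qed

end

section \<open>Principal bundles\<close>

text \<open>Splits each chart into its group coordinate \<open>h j\<close> and the inverse chart
  \<open>k j\<close>: transport combines the two, while the difference of two points of a fibre is
  read off from \<open>h j\<close>.\<close>

lemma principal_bundle_trivialisations:
  fixes B :: "'b topology"
  assumes TG: "topological_group G TG" and bun: "numerable_principal_bundle G TG ract E B p"
  obtains J U h k where "numerable_cover B (J :: 'b set set) U"
    "\<And>j. j \<in> J \<Longrightarrow> continuous_map (subtopology E {e\<in>topspace E. p e \<in> U j}) TG (h j)"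
    "\<And>j. j \<in> J \<Longrightarrow> continuous_map (prod_topology (subtopology B (U j)) TG) E (k j)"
    "\<And>j e. j \<in> J \<Longrightarrow> e \<in> topspace E \<Longrightarrow> p e \<in> U j \<Longrightarrow> h j e \<in> carrier G \<and> k j (p e, h j e) = e"
    "\<And>j e g. j \<in> J \<Longrightarrow> e \<in> topspace E \<Longrightarrow> p e \<in> U j \<Longrightarrow> g \<in> carrier G \<Longrightarrow> h j (ract e g) = h j e \<otimes>\<^bsub>G\<^esub> g"
    "\<And>j c g. j \<in> J \<Longrightarrow> c \<in> topspace B \<Longrightarrow> c \<in> U j \<Longrightarrow> g \<in> carrier G \<Longrightarrow>
       k j (c, g) \<in> topspace E \<and> p (k j (c, g)) = c \<and> h j (k j (c, g)) = g"
proof -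
  have tTG: "topspace TG = carrier G" using TG by (simp add: topological_group_def)
  obtain J :: "'b set set" and U where cover: "numerable_cover B J U" and
    triv: "\<forall>j\<in>J. \<exists>h. homeomorphic_map (subtopology E {e\<in>topspace E. p e \<in> U j})
                                     (prod_topology (subtopology B (U j)) TG) h \<and>
                  (\<forall>e\<in>topspace E. p e \<in> U j \<longrightarrow> fst (h e) = p e) \<and>
                  (\<forall>e\<in>topspace E. \<forall>g\<in>carrier G. p e \<in> U j \<longrightarrow>
                       h (ract e g) = (p e, snd (h e) \<otimes>\<^bsub>G\<^esub> g))"
    using bun unfolding numerable_principal_bundle_def by blast
  from bchoice[OF triv] obtain H where HH: "\<forall>j\<in>J. homeomorphic_map (subtopology E {e\<in>topspace E. p e \<in> U j})
                                     (prod_topology (subtopology B (U j)) TG) (H j) \<and>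
                  (\<forall>e\<in>topspace E. p e \<in> U j \<longrightarrow> fst (H j e) = p e) \<and>
                  (\<forall>e\<in>topspace E. \<forall>g\<in>carrier G. p e \<in> U j \<longrightarrow>
                       H j (ract e g) = (p e, snd (H j e) \<otimes>\<^bsub>G\<^esub> g))" ..
  have H1: "\<And>j e. j \<in> J \<Longrightarrow> e \<in> topspace E \<Longrightarrow> p e \<in> U j \<Longrightarrow> fst (H j e) = p e"
    and H2: "\<And>j e g. j \<in> J \<Longrightarrow> e \<in> topspace E \<Longrightarrow> g \<in> carrier G \<Longrightarrow> p e \<in> U j \<Longrightarrow>
        H j (ract e g) = (p e, snd (H j e) \<otimes>\<^bsub>G\<^esub> g)"
    using HH by simp_all
  have "\<forall>j\<in>J. \<exists>k. homeomorphic_maps (subtopology E {e\<in>topspace E. p e \<in> U j})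
        (prod_topology (subtopology B (U j)) TG) (H j) k"
    using HH by (simp add: homeomorphic_map_maps)
  from bchoice[OF this] obtain k where k: "\<forall>j\<in>J. homeomorphic_maps (subtopology E {e\<in>topspace E. p e \<in> U j})
        (prod_topology (subtopology B (U j)) TG) (H j) (k j)" ..
  show thesis
  proof (rule that[OF cover, of "\<lambda>j e. snd (H j e)" k])
    fix j assume j: "j \<in> J"
    note k = bspec[OF k j, unfolded homeomorphic_maps_def]
    have Hc: "continuous_map (subtopology E {e\<in>topspace E. p e \<in> U j}) (prod_topology (subtopology B (U j)) TG) (H j)"
      and kc: "continuous_map (prod_topology (subtopology B (U j)) TG) (subtopology E {e\<in>topspace E. p e \<in> U j}) (k j)"
      using k by auto
    show "continuous_map (subtopology E {e\<in>topspace E. p e \<in> U j}) TG (\<lambda>e. snd (H j e))"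
      using continuous_map_compose[OF Hc continuous_map_snd] by (simp add: o_def)
    show "continuous_map (prod_topology (subtopology B (U j)) TG) E (k j)"
      using kc by (simp add: continuous_map_in_subtopology)
    show "snd (H j e) \<in> carrier G \<and> k j (p e, snd (H j e)) = e" if "e \<in> topspace E" "p e \<in> U j" for e
    proof -
      have e: "e \<in> topspace (subtopology E {e\<in>topspace E. p e \<in> U j})" using that by simp
      have "H j e \<in> topspace (prod_topology (subtopology B (U j)) TG)"
        using continuous_map_image_subset_topspace[OF Hc] e by blast
      moreover have "H j e = (p e, snd (H j e))" using H1[OF j that] by (simp add: prod_eq_iff)
      ultimately show ?thesis using k e tTG by (metis SigmaE2 topspace_prod_topology)
    qed
    show "snd (H j (ract e g)) = snd (H j e) \<otimes>\<^bsub>G\<^esub> g" if "e \<in> topspace E" "p e \<in> U j" "g \<in> carrier G" for e g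
      using H2[OF j that(1,3,2)] by simp
    show "k j (c, g) \<in> topspace E \<and> p (k j (c, g)) = c \<and> snd (H j (k j (c, g))) = g"
      if "c \<in> topspace B" "c \<in> U j" "g \<in> carrier G" for c g
    proof -
      have cg: "(c, g) \<in> topspace (prod_topology (subtopology B (U j)) TG)" using that tTG by simp
      then have "k j (c, g) \<in> topspace (subtopology E {e\<in>topspace E. p e \<in> U j})"
        using continuous_map_image_subset_topspace[OF kc] by blast
      then have kE: "k j (c, g) \<in> topspace E" "p (k j (c, g)) \<in> U j" by auto
      moreover have "H j (k j (c, g)) = (c, g)" using k cg by blast
      ultimately show ?thesis using H1[OF j kE] by simp
    qed
  qed
qed

lemma principal_bundle_action:
  assumes bun: "numerable_principal_bundle G TG ract E B p" and tTG: "topspace TG = carrier G"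
    and "e \<in> topspace E" "g \<in> carrier G"
  shows "ract e g \<in> topspace E" "p (ract e g) = p e"
proof -
  have "continuous_map (prod_topology E TG) E (\<lambda>(e, g). ract e g)"
    using bun by (simp add: numerable_principal_bundle_def right_G_space_def)
  from subsetD[OF continuous_map_image_subset_topspace[OF this] imageI[of "(e, g)"]]
  show E: "ract e g \<in> topspace E" using assms by simp
  show "p (ract e g) = p e"
    using bun assms(3,4) E unfolding numerable_principal_bundle_def by metis
qed

text \<open>Transport inside a chart keeps the group coordinate and changes the base point. It
  commutes with the right action because \<open>h j\<close> turns that action into right
  multiplication.\<close>

lemma principal_bundle_local_transport:
  fixes B :: "'b topology"
  assumes TG: "topological_group G TG" and bun: "numerable_principal_bundle G TG ract E B p"
  obtains J :: "'b set set" and \<phi> \<tau> where "local_transport E B p J \<phi> \<tau> ((\<lambda>g e. ract e g) ` carrier G)"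
proof -
  have tTG: "topspace TG = carrier G" using TG by (simp add: topological_group_def)
  note act = principal_bundle_action[OF bun tTG]
  obtain J :: "'b set set" and U h k where cover: "numerable_cover B J U"
    and hc: "\<And>j. j \<in> J \<Longrightarrow> continuous_map (subtopology E {e\<in>topspace E. p e \<in> U j}) TG (h j)"
    and kc: "\<And>j. j \<in> J \<Longrightarrow> continuous_map (prod_topology (subtopology B (U j)) TG) E (k j)"
    and kh: "\<And>j e. j \<in> J \<Longrightarrow> e \<in> topspace E \<Longrightarrow> p e \<in> U j \<Longrightarrow> h j e \<in> carrier G \<and> k j (p e, h j e) = e"
    and hg: "\<And>j e g. j \<in> J \<Longrightarrow> e \<in> topspace E \<Longrightarrow> p e \<in> U j \<Longrightarrow> g \<in> carrier G \<Longrightarrow>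
      h j (ract e g) = h j e \<otimes>\<^bsub>G\<^esub> g"
    and hk: "\<And>j c g. j \<in> J \<Longrightarrow> c \<in> topspace B \<Longrightarrow> c \<in> U j \<Longrightarrow> g \<in> carrier G \<Longrightarrow>
       k j (c, g) \<in> topspace E \<and> p (k j (c, g)) = c \<and> h j (k j (c, g)) = g"
    by (rule principal_bundle_trivialisations[OF TG bun]) (rule that)
  have "\<exists>\<phi>::'b set \<Rightarrow> 'b \<Rightarrow> real.
        (\<forall>j\<in>J. continuous_map B euclideanreal (\<phi> j) \<and>
               (\<forall>b\<in>topspace B. 0 \<le> \<phi> j b) \<and>
               {b \<in> topspace B. \<phi> j b > 0} \<subseteq> U j) \<and>
        (\<forall>b\<in>topspace B. \<exists>V. openin B V \<and> b \<in> V \<and>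
               finite {j\<in>J. \<exists>c\<in>V. \<phi> j c > 0}) \<and>
        (\<forall>b\<in>topspace B. (\<Sum>j\<in>{j\<in>J. \<phi> j b > 0}. \<phi> j b) = 1)"
    using cover by (simp add: numerable_cover_def)
  then obtain \<phi> :: "'b set \<Rightarrow> 'b \<Rightarrow> real" where \<phi>:
    "\<forall>j\<in>J. continuous_map B euclideanreal (\<phi> j) \<and>
       (\<forall>b\<in>topspace B. 0 \<le> \<phi> j b) \<and> {b \<in> topspace B. \<phi> j b > 0} \<subseteq> U j"
    "\<forall>b\<in>topspace B. \<exists>V. openin B V \<and> b \<in> V \<and> finite {j\<in>J. \<exists>c\<in>V. \<phi> j c > 0}"
    "\<forall>b\<in>topspace B. (\<Sum>j\<in>{j\<in>J. \<phi> j b > 0}. \<phi> j b) = 1"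
    by (elim exE conjE) (rule that)
  have U: "c \<in> U j" if "j \<in> J" "c \<in> topspace B" "0 < \<phi> j c" for j c using \<phi>(1) that by blast
  have pc: "continuous_map E B p"
    using bun quotient_imp_continuous_map by (auto simp: numerable_principal_bundle_def)
  have pt: "p e \<in> topspace B" if "e \<in> topspace E" for e
    using continuous_map_image_subset_topspace[OF pc] that by blast
  define \<tau> where "\<tau> j c e = k j (c, h j e)" for j c e
  have "local_transport E B p J \<phi> \<tau> ((\<lambda>g e. ract e g) ` carrier G)"
  proof
    show "\<exists>j\<in>J. 0 < \<phi> j b" if "b \<in> topspace B" for b
    proof (rule ccontr)
      assume "\<not> ?thesis"
      then have none: "{j\<in>J. \<phi> j b > 0} = {}" by blast
      show False using bspec[OF \<phi>(3) that] unfolding none by simp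
    qed
    show "continuous_map (subtopology (prod_topology B E) {(c, e). 0 < \<phi> j c \<and> 0 < \<phi> j (p e)}) E
        (\<lambda>(c, e). \<tau> j c e)" if j: "j \<in> J" for j
    proof -
      let ?Y = "subtopology (prod_topology B E) {(c, e). 0 < \<phi> j c \<and> 0 < \<phi> j (p e)}"
      have 1: "continuous_map ?Y (subtopology B (U j)) fst"
        using U[OF j]
          by (intro continuous_map_into_subtopology[OF continuous_map_from_subtopology[OF continuous_map_fst]]) auto
      have "continuous_map ?Y (subtopology E {e\<in>topspace E. p e \<in> U j}) snd"
        using U[OF j] pt
        by (intro continuous_map_into_subtopology[OF continuous_map_from_subtopology[OF continuous_map_snd]]) auto
      from continuous_map_compose[OF this hc[OF j]]
      have "continuous_map ?Y (prod_topology (subtopology B (U j)) TG) (\<lambda>y. (fst y, h j (snd y)))"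
        by (intro continuous_map_pairedI 1) (simp add: o_def)
      from continuous_map_compose[OF this kc[OF j]] show ?thesis
        by (simp add: \<tau>_def o_def case_prod_unfold)
    qed
    show "p (\<tau> j c e) = c" if "j \<in> J" "c \<in> topspace B" "e \<in> topspace E" "0 < \<phi> j c" "0 < \<phi> j (p e)" for j c e
      using that U pt kh hk by (simp add: \<tau>_def)
    show "\<tau> j (p e) e = e" if "j \<in> J" "e \<in> topspace E" "0 < \<phi> j (p e)" for j e
      using that U pt kh by (simp add: \<tau>_def)
    show "\<sigma> e \<in> topspace E \<and> p (\<sigma> e) = p e" if "\<sigma> \<in> (\<lambda>g e. ract e g) ` carrier G" "e \<in> topspace E" for \<sigma> e
      using that act by auto
    show "\<tau> j c (\<sigma> e) = \<sigma> (\<tau> j c e)"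
      if j: "j \<in> J" and c: "c \<in> topspace B" "0 < \<phi> j c" and e: "e \<in> topspace E" "0 < \<phi> j (p e)"
        and \<sigma>: "\<sigma> \<in> (\<lambda>g e. ract e g) ` carrier G" for j c e \<sigma>
    proof -
      obtain g where g: "g \<in> carrier G" "\<sigma> = (\<lambda>e. ract e g)" using \<sigma> by blast
      have Uj: "c \<in> U j" "p e \<in> U j" using U[OF j] c e pt by auto
      have he: "h j e \<in> carrier G" using kh[OF j e(1) Uj(2)] by blast
      let ?e = "k j (c, h j e)"
      have k: "?e \<in> topspace E" "p ?e = c" "h j ?e = h j e" using hk[OF j c(1) Uj(1) he] by auto
      have "\<sigma> (\<tau> j c e) = k j (p (ract ?e g), h j (ract ?e g))"
        using kh[OF j act(1)[OF k(1) g(1)]] act(2)[OF k(1) g(1)] k(2) Uj(1) by (simp add: \<tau>_def g(2))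
      also have "\<dots> = \<tau> j c (\<sigma> e)"
        using hg[OF j k(1) _ g(1)] hg[OF j e(1) Uj(2) g(1)] act(2)[OF k(1) g(1)] k Uj(1) by (simp add: \<tau>_def g(2))
      finally show ?thesis by simp
    qed
  qed (use pc \<phi> in auto)
  then show thesis by (rule that)
qed

text \<open>The translation function of the principal bundle. Uniqueness of the group element
  follows from cancellation in the group coordinate of a chart, and continuity from the local
  formula \<open>inv (h j e) \<otimes> h j e'\<close>.\<close>

lemma principal_bundle_difference:
  fixes B :: "'b topology"
  assumes TG: "topological_group G TG" and bun: "numerable_principal_bundle G TG ract E B p"
  obtains d where "continuous_map (subtopology (prod_topology E E) {(e, e'). p e = p e'}) TG (\<lambda>(e, e'). d e e')"
    "\<And>e e'. e \<in> topspace E \<Longrightarrow> e' \<in> topspace E \<Longrightarrow> p e = p e' \<Longrightarrow> d e e' \<in> carrier G \<and> ract e (d e e') = e'"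
    "\<And>e g. e \<in> topspace E \<Longrightarrow> g \<in> carrier G \<Longrightarrow> d e (ract e g) = g"
proof -
  have tTG: "topspace TG = carrier G" and grp: "group G"
    and mult: "continuous_map (prod_topology TG TG) TG (\<lambda>(a, b). a \<otimes>\<^bsub>G\<^esub> b)"
    and inv: "continuous_map TG TG (\<lambda>a. inv\<^bsub>G\<^esub> a)"
    using TG by (auto simp: topological_group_def)
  interpret group G by (rule grp)
  note act = principal_bundle_action[OF bun tTG]
  obtain J :: "'b set set" and U h k where cover: "numerable_cover B J U"
    and hc: "\<And>j. j \<in> J \<Longrightarrow> continuous_map (subtopology E {e\<in>topspace E. p e \<in> U j}) TG (h j)"
    and kc: "\<And>j. j \<in> J \<Longrightarrow> continuous_map (prod_topology (subtopology B (U j)) TG) E (k j)"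
    and kh: "\<And>j e. j \<in> J \<Longrightarrow> e \<in> topspace E \<Longrightarrow> p e \<in> U j \<Longrightarrow> h j e \<in> carrier G \<and> k j (p e, h j e) = e"
    and hg: "\<And>j e g. j \<in> J \<Longrightarrow> e \<in> topspace E \<Longrightarrow> p e \<in> U j \<Longrightarrow> g \<in> carrier G \<Longrightarrow>
      h j (ract e g) = h j e \<otimes>\<^bsub>G\<^esub> g"
    and hk: "\<And>j c g. j \<in> J \<Longrightarrow> c \<in> topspace B \<Longrightarrow> c \<in> U j \<Longrightarrow> g \<in> carrier G \<Longrightarrow>
       k j (c, g) \<in> topspace E \<and> p (k j (c, g)) = c \<and> h j (k j (c, g)) = g"
    by (rule principal_bundle_trivialisations[OF TG bun]) (rule that)
  have pc: "continuous_map E B p"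
    using bun quotient_imp_continuous_map by (auto simp: numerable_principal_bundle_def)
  have pt: "p e \<in> topspace B" if "e \<in> topspace E" for e
    using continuous_map_image_subset_topspace[OF pc] that by blast
  have U: "openin B (U j)" if "j \<in> J" for j using cover that by (simp add: numerable_cover_def)
  have cov: "\<exists>j\<in>J. p e \<in> U j" if "e \<in> topspace E" for e
    using cover pt[OF that] unfolding numerable_cover_def by blast
  define d where "d e e' = (THE g. g \<in> carrier G \<and> ract e g = e')" for e e'
  have dg: "d e (ract e g) = g" if e: "e \<in> topspace E" and g: "g \<in> carrier G" for e g
    unfolding d_def
  proof (rule the_equality)
    fix g' assume g': "g' \<in> carrier G \<and> ract e g' = ract e g"
    obtain j where j: "j \<in> J" "p e \<in> U j" using cov[OF e] by blast
    have "h j e \<otimes>\<^bsub>G\<^esub> g' = h j e \<otimes>\<^bsub>G\<^esub> g"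
      using hg[OF j(1) e j(2), of g'] hg[OF j(1) e j(2) g] g' by simp
    then show "g' = g" using kh[OF j(1) e j(2)] g g' by simp
  qed (use g in simp)
  have ex: "\<exists>g\<in>carrier G. e' = ract e g" if "e \<in> topspace E" "e' \<in> topspace E" "p e = p e'" for e e'
    using bun that unfolding numerable_principal_bundle_def by blast
  show thesis
  proof (rule that[of d])
    show "d e e' \<in> carrier G \<and> ract e (d e e') = e'"
      if "e \<in> topspace E" "e' \<in> topspace E" "p e = p e'" for e e'
      using ex[OF that] dg[OF that(1)] by auto
    show "d e (ract e g) = g" if "e \<in> topspace E" "g \<in> carrier G" for e g by (rule dg[OF that])
    let ?Y = "subtopology (prod_topology E E) {(e, e'). p e = p e'}"
    show "continuous_map ?Y TG (\<lambda>(e, e'). d e e')"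
    proof (rule continuous_map_local)
      fix y assume y: "y \<in> topspace ?Y"
      have c1: "continuous_map ?Y E fst" and c2: "continuous_map ?Y E snd"
        by (intro continuous_map_from_subtopology continuous_map_fst continuous_map_snd)+
      obtain j where j: "j \<in> J" "p (fst y) \<in> U j" using cov[of "fst y"] y by auto
      let ?V = "{y \<in> topspace ?Y. p (fst y) \<in> U j}"
      have "openin ?Y ?V"
        using openin_continuous_map_preimage[OF continuous_map_compose[OF c1 pc] U[OF j(1)]] by (simp add: o_def)
      moreover have "continuous_map (subtopology ?Y ?V) TG (\<lambda>y. inv\<^bsub>G\<^esub> (h j (fst y)) \<otimes>\<^bsub>G\<^esub> h j (snd y))"
      proof -
        have f: "continuous_map (subtopology ?Y ?V) (subtopology E {e\<in>topspace E. p e \<in> U j}) fst"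
          by (rule continuous_map_into_subtopology[OF continuous_map_from_subtopology[OF c1]]) auto
        have s: "continuous_map (subtopology ?Y ?V) (subtopology E {e\<in>topspace E. p e \<in> U j}) snd"
          by (rule continuous_map_into_subtopology[OF continuous_map_from_subtopology[OF c2]]) auto
        have "continuous_map (subtopology ?Y ?V) TG (\<lambda>y. inv\<^bsub>G\<^esub> (h j (fst y)))"
          using continuous_map_compose[OF continuous_map_compose[OF f hc[OF j(1)]] inv] by (simp add: o_def)
        moreover have "continuous_map (subtopology ?Y ?V) TG (\<lambda>y. h j (snd y))"
          using continuous_map_compose[OF s hc[OF j(1)]] by (simp add: o_def)
        ultimately show ?thesis by (rule continuous_map_compose2[OF mult])
      qed
      moreover have "(case v of (e, e') \<Rightarrow> d e e') = inv\<^bsub>G\<^esub> (h j (fst v)) \<otimes>\<^bsub>G\<^esub> h j (snd v)" if v: "v \<in> ?V" for v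
      proof -
        obtain e e' where e: "v = (e, e')" "e \<in> topspace E" "e' \<in> topspace E" "p e = p e'" "p e \<in> U j"
          using v by auto
        obtain g where g: "g \<in> carrier G" "e' = ract e g" using ex[OF e(2-4)] by blast
        have "h j e \<in> carrier G" using kh[OF j(1) e(2,5)] by blast
        then have "inv\<^bsub>G\<^esub> (h j e) \<otimes>\<^bsub>G\<^esub> (h j e \<otimes>\<^bsub>G\<^esub> g) = g"
          using g(1) by (simp add: m_assoc[symmetric])
        then show ?thesis using hg[OF j(1) e(2,5) g(1)] dg[OF e(2) g(1)] by (simp add: e(1) g(2))
      qed
      ultimately show "\<exists>V f'. openin ?Y V \<and> y \<in> V \<and> continuous_map (subtopology ?Y V) TG f' \<and>
          (\<forall>v\<in>V. (case v of (e, e') \<Rightarrow> d e e') = f' v)"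
        using y j(2) by blast
    qed
  qed
qed

section \<open>Motion planners\<close>

text \<open>Products of quotient maps need not be quotient maps, whereas products of open maps are
  open; this is how the quotient map \<open>q\<close> is squared and multiplied with the interval
  below.\<close>

lemma open_map_prod:
  assumes f: "open_map A A' f" and g: "open_map B B' g"
  shows "open_map (prod_topology A B) (prod_topology A' B') (\<lambda>z. (f (fst z), g (snd z)))"
  unfolding open_map_def
proof (intro allI impI)
  fix O' assume O': "openin (prod_topology A B) O'"
  show "openin (prod_topology A' B') ((\<lambda>z. (f (fst z), g (snd z))) ` O')"
  proof (subst openin_subopen, intro ballI)
    fix y assume "y \<in> (\<lambda>z. (f (fst z), g (snd z))) ` O'"
    then obtain a b where ab: "(a, b) \<in> O'" "y = (f a, g b)" by auto
    have "\<exists>U V. openin A U \<and> openin B V \<and> a \<in> U \<and> b \<in> V \<and> U \<times> V \<subseteq> O'"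
      using O' ab(1) by (simp add: openin_prod_topology_alt)
    then obtain U V where UV: "openin A U" "openin B V" "a \<in> U" "b \<in> V" "U \<times> V \<subseteq> O'"
      by blast
    have "openin (prod_topology A' B') (f ` U \<times> g ` V)"
      using f g UV by (simp add: open_map_def openin_prod_Times_iff)
    moreover have "f ` U \<times> g ` V \<subseteq> (\<lambda>z. (f (fst z), g (snd z))) ` O'"
    proof
      fix w assume "w \<in> f ` U \<times> g ` V"
      then obtain u v where "u \<in> U" "v \<in> V" "w = (f u, g v)" by blast
      then show "w \<in> (\<lambda>z. (f (fst z), g (snd z))) ` O'"
        using UV(5) by (intro image_eqI[of _ _ "(u, v)"]) auto
    qed
    moreover have "y \<in> f ` U \<times> g ` V" using ab UV by blast
    ultimately show "\<exists>T. openin (prod_topology A' B') T \<and> y \<in> T \<and> T \<subseteq> (\<lambda>z. (f (fst z), g (snd z))) ` O'"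
      by blast
  qed
qed

section \<open>Sections up to homotopy made strict\<close>

text \<open>Keeps the rescaled times in the unit interval, so that each branch of the concatenation
  below is continuous for all parameters before the branches are glued.\<close>

definition clamp :: "real \<Rightarrow> real" where
  "clamp x = max 0 (min 1 x)"

text \<open>When \<open>H\<close> runs from \<open>(s u 0, s u 1)\<close> to \<open>u\<close>, this
  follows its first coordinate backwards from \<open>fst u\<close> to \<open>s u 0\<close>, then the
  path \<open>s u\<close>, then its second coordinate forwards to \<open>snd u\<close>. The
  components of \<open>u\<close> are thus joined exactly, and equivariance of \<open>s\<close> and
  \<open>H\<close> is inherited.\<close>

definition straighten :: "('u \<Rightarrow> real \<Rightarrow> 'a) \<Rightarrow> (real \<times> 'u \<Rightarrow> 'a \<times> 'a) \<Rightarrow> 'u \<Rightarrow> real \<Rightarrow> 'a" where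
  "straighten s H u t =
     (if t \<le> 1/3 then fst (H (clamp (1 - 3 * t), u))
      else if t \<le> 2/3 then s u (clamp (3 * t - 1))
      else snd (H (clamp (3 * t - 2), u)))"

lemma clamp_unit: "clamp x \<in> {0..1}"
  by (simp add: clamp_def)

lemma straighten_ends:
  assumes "H (1, u) = u"
  shows "straighten s H u 0 = fst u" "straighten s H u 1 = snd u"
  using assms by (simp_all add: straighten_def clamp_def)

lemma continuous_map_straighten:
  assumes s: "continuous_map Y (path_space X) s"
    and H: "continuous_map (prod_topology unit_I Y) (prod_topology X X) H"
    and H0: "\<And>u. u \<in> topspace Y \<Longrightarrow> H (0, u) = (s u 0, s u 1)"
  shows "continuous_map (prod_topology Y unit_I) X (\<lambda>(u, t). straighten s H u t)"
proof -
  let ?Z = "prod_topology Y unit_I"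
  have t: "continuous_map ?Z euclideanreal snd"
    using continuous_map_snd[of Y unit_I] by (simp add: continuous_map_in_subtopology)
  have cl: "continuous_map ?Z unit_I (\<lambda>z. clamp (f z))" if "continuous_map ?Z euclideanreal f" for f
    using that clamp_unit unfolding clamp_def
    by (intro continuous_map_into_subtopology continuous_map_real_max continuous_map_real_min) auto
  have Hc: "continuous_map ?Z (prod_topology X X) (\<lambda>z. H (clamp (f z), fst z))"
    if "continuous_map ?Z euclideanreal f" for f
    using continuous_map_compose[OF continuous_map_pairedI[OF cl[OF that] continuous_map_fst] H] by (simp add: o_def)
  have 1: "continuous_map ?Z X (\<lambda>z. fst (H (clamp (1 - 3 * snd z), fst z)))"
    using continuous_map_compose[OF Hc continuous_map_fst, of "\<lambda>z. 1 - 3 * snd z"] t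
    by (simp add: o_def continuous_map_diff continuous_map_real_mult)
  have 3: "continuous_map ?Z X (\<lambda>z. snd (H (clamp (3 * snd z - 2), fst z)))"
    using continuous_map_compose[OF Hc continuous_map_snd, of "\<lambda>z. 3 * snd z - 2"] t
    by (simp add: o_def continuous_map_diff continuous_map_real_mult)
  have 2: "continuous_map ?Z X (\<lambda>z. s (fst z) (clamp (3 * snd z - 1)))"
    by (rule continuous_map_compose2[OF continuous_map_path_space_eval[OF s] continuous_map_fst cl])
      (intro continuous_map_diff continuous_map_real_mult t; simp)
  have 23: "continuous_map ?Z X (\<lambda>z. if snd z \<le> 2/3 then s (fst z) (clamp (3 * snd z - 1))
      else snd (H (clamp (3 * snd z - 2), fst z)))"
    by (rule continuous_map_cases_le[OF t _ continuous_map_from_subtopology[OF 2] continuous_map_from_subtopology[OF 3]])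
      (use H0 in \<open>auto simp: clamp_def\<close>)
  have "continuous_map ?Z X (\<lambda>z. if snd z \<le> 1/3 then fst (H (clamp (1 - 3 * snd z), fst z))
      else if snd z \<le> 2/3 then s (fst z) (clamp (3 * snd z - 1)) else snd (H (clamp (3 * snd z - 2), fst z)))"
    by (rule continuous_map_cases_le[OF t _ continuous_map_from_subtopology[OF 1] continuous_map_from_subtopology[OF 23]])
      (use H0 in \<open>auto simp: clamp_def\<close>)
  then show ?thesis by (simp add: straighten_def case_prod_unfold)
qed

text \<open>The empty set has infimum \<open>\<infinity>\<close>, and a nonempty set of naturals has
  a least element.\<close>

lemma INF_enat_attained:
  assumes "(INF k\<in>S. enat k) = enat l"
  shows "l \<in> S"
proof -
  have "S \<noteq> {}" using assms by (auto simp: top_enat_def)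
  then have "(INF k\<in>S. enat k) \<in> enat ` S"
    unfolding Inf_enat_def by (auto intro: LeastI)
  then show ?thesis using assms by auto
qed

text \<open>The strict form of a local motion planner: the endpoints are met exactly, and the paths
  are uncurried, so that lifting and descent deal with maps into \<open>Y\<close> and not with a
  function space.\<close>

definition planner :: "'a topology \<Rightarrow> ('a \<times> 'a) set \<Rightarrow> (('a \<times> 'a) \<times> real \<Rightarrow> 'a) \<Rightarrow> bool" where
  "planner Y V F \<longleftrightarrow> openin (prod_topology Y Y) V \<and>
     continuous_map (prod_topology (subtopology (prod_topology Y Y) V) unit_I) Y F \<and>
     (\<forall>v\<in>V. F (v, 0) = fst v \<and> F (v, 1) = snd v)"

definition equivariant_planner ::
  "('g, 'm) monoid_scheme \<Rightarrow> ('g \<Rightarrow> 'a \<Rightarrow> 'a) \<Rightarrow> 'a topology \<Rightarrow> ('a \<times> 'a) set \<Rightarrow> (('a \<times> 'a) \<times> real \<Rightarrow> 'a) \<Rightarrow> bool" where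
  "equivariant_planner G act X U F \<longleftrightarrow> planner X U F \<and>
     (\<forall>g\<in>carrier G. \<forall>(a, b)\<in>U. (act g a, act g b) \<in> U \<and>
        (\<forall>t\<in>{0..1}. F ((act g a, act g b), t) = act g (F ((a, b), t))))"

lemma TC_witness:
  fixes Y :: "'a topology"
  assumes "TC Y = enat l"
  obtains V F where "topspace (prod_topology Y Y) \<subseteq> (\<Union>i<l. V i)"
    "\<And>i. i < l \<Longrightarrow> planner Y (V i) (F i)"
proof -
  let ?Q = "prod_topology Y Y"
  have "l \<in> {k::nat. \<exists>Us::nat \<Rightarrow> ('a \<times> 'a) set. topspace ?Q \<subseteq> (\<Union>i<k. Us i) \<and>
       (\<forall>i<k. openin ?Q (Us i) \<and>
          (\<exists>s. continuous_map (subtopology ?Q (Us i)) (path_space Y) s \<and>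
               homotopic_with (\<lambda>_. True) (subtopology ?Q (Us i)) ?Q ((\<lambda>\<gamma>. (\<gamma> 0, \<gamma> 1)) \<circ> s) id))}"
    using assms unfolding TC_def secat_def by (rule INF_enat_attained)
  then obtain V where cov: "topspace ?Q \<subseteq> (\<Union>i<l. V i)"
    and V: "\<forall>i<l. openin ?Q (V i) \<and>
          (\<exists>s. continuous_map (subtopology ?Q (V i)) (path_space Y) s \<and>
               homotopic_with (\<lambda>_. True) (subtopology ?Q (V i)) ?Q ((\<lambda>\<gamma>. (\<gamma> 0, \<gamma> 1)) \<circ> s) id)"
    by blast
  have "\<exists>F. planner Y (V i) F" if i: "i < l" for i
  proof -
    obtain s where s: "continuous_map (subtopology ?Q (V i)) (path_space Y) s"
      and h: "homotopic_with (\<lambda>_. True) (subtopology ?Q (V i)) ?Q ((\<lambda>\<gamma>. (\<gamma> 0, \<gamma> 1)) \<circ> s) id"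
      using V i by blast
    obtain H where H: "continuous_map (prod_topology unit_I (subtopology ?Q (V i))) ?Q H"
      "\<forall>v. H (0, v) = (s v 0, s v 1)" "\<forall>v. H (1, v) = v"
      using h unfolding homotopic_with_def o_def id_def by blast
    have "continuous_map (prod_topology (subtopology ?Q (V i)) unit_I) Y (\<lambda>(u, t). straighten s H u t)"
      by (rule continuous_map_straighten[OF s H(1)]) (simp add: H(2))
    then show ?thesis
      unfolding planner_def using H(3) V i
      by (intro exI[of _ "\<lambda>(u, t). straighten s H u t"]) (auto simp: straighten_ends)
  qed
  then have "\<forall>i. \<exists>F. i < l \<longrightarrow> planner Y (V i) F" by blast
  from choice[OF this] obtain F where "\<forall>i. i < l \<longrightarrow> planner Y (V i) (F i)" ..
  then show thesis using that[OF cov] by blast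
qed

lemma TC_G_witness:
  fixes X :: "'b topology"
  assumes "TC_G G act X = enat l"
  obtains U F where "topspace (prod_topology X X) \<subseteq> (\<Union>i<l. U i)"
    "\<And>i. i < l \<Longrightarrow> equivariant_planner G act X (U i) (F i)"
proof -
  let ?Q = "prod_topology X X"
  let ?inv = "\<lambda>U. \<forall>g\<in>carrier G. \<forall>(a, b)\<in>U. (act g a, act g b) \<in> U"
  let ?P = "\<lambda>U s. continuous_map (subtopology ?Q U) (path_space X) s \<and>
               (\<forall>g\<in>carrier G. \<forall>(a,b)\<in>U. \<forall>t\<in>{0..1}.
                    s (act g a, act g b) t = act g (s (a,b) t)) \<and>
               (\<exists>H. continuous_map (prod_topology unit_I (subtopology ?Q U)) ?Q H \<and>
                    (\<forall>u\<in>U. H (0, u) = (s u 0, s u 1)) \<and>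
                    (\<forall>u\<in>U. H (1, u) = u) \<and>
                    (\<forall>g\<in>carrier G. \<forall>t\<in>{0..1}. \<forall>(a,b)\<in>U.
                       H (t, (act g a, act g b)) = (act g (fst (H (t,(a,b)))), act g (snd (H (t,(a,b)))))))"
  have "l \<in> {k::nat. \<exists>Us::nat \<Rightarrow> ('b \<times> 'b) set. topspace ?Q \<subseteq> (\<Union>i<k. Us i) \<and>
       (\<forall>i<k. openin ?Q (Us i) \<and> ?inv (Us i) \<and> (\<exists>s. ?P (Us i) s))}"
    using assms unfolding TC_G_def by (rule INF_enat_attained)
  then obtain U where cov: "topspace ?Q \<subseteq> (\<Union>i<l. U i)"
    and U: "\<forall>i<l. openin ?Q (U i) \<and> ?inv (U i) \<and> (\<exists>s. ?P (U i) s)"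
    by blast
  have "\<exists>F. equivariant_planner G act X (U i) F" if i: "i < l" for i
  proof -
    have tU: "topspace (subtopology ?Q (U i)) = U i"
      using openin_subset[of ?Q "U i"] U i topspace_subtopology_subset[of "U i" ?Q] by simp
    from U i have "\<exists>s. ?P (U i) s" by simp
    then obtain s where s: "?P (U i) s" ..
    then obtain H where H: "continuous_map (prod_topology unit_I (subtopology ?Q (U i))) ?Q H"
      "\<forall>u\<in>U i. H (0, u) = (s u 0, s u 1)" "\<forall>u\<in>U i. H (1, u) = u"
      "\<forall>g\<in>carrier G. \<forall>t\<in>{0..1}. \<forall>(a,b)\<in>U i.
         H (t, (act g a, act g b)) = (act g (fst (H (t,(a,b)))), act g (snd (H (t,(a,b)))))"
      by blast
    have "continuous_map (prod_topology (subtopology ?Q (U i)) unit_I) X (\<lambda>(u, t). straighten s H u t)"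
      by (rule continuous_map_straighten[OF conjunct1[OF s] H(1)]) (use H(2) tU in auto)
    moreover have "straighten s H (act g a, act g b) t = act g (straighten s H (a, b) t)"
      if "g \<in> carrier G" "(a, b) \<in> U i" for g a b t
    proof -
      have "H (clamp x, (act g a, act g b)) = (act g (fst (H (clamp x,(a,b)))), act g (snd (H (clamp x,(a,b)))))"
        "s (act g a, act g b) (clamp x) = act g (s (a, b) (clamp x))" for x
        using H(4) s that clamp_unit[of x] by blast+
      then show ?thesis by (simp add: straighten_def)
    qed
    moreover have "openin ?Q (U i)" using U i by blast
    moreover have "(act g a, act g b) \<in> U i" if "g \<in> carrier G" "(a, b) \<in> U i" for g a b
      using U i that by blast
    ultimately show ?thesis
      unfolding equivariant_planner_def planner_def using H(3)
      by (intro exI[of _ "\<lambda>(u, t). straighten s H u t"]) (auto simp: straighten_ends)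
  qed
  then have "\<forall>i. \<exists>F. i < l \<longrightarrow> equivariant_planner G act X (U i) F" by blast
  from choice[OF this] obtain F where "\<forall>i. i < l \<longrightarrow> equivariant_planner G act X (U i) (F i)" ..
  then show thesis using that[OF cov] by blast
qed

text \<open>A strict planner is a section on the nose, so the constant homotopy serves.\<close>

lemma TC_le:
  assumes cov: "topspace (prod_topology Y Y) \<subseteq> (\<Union>i<n. W i)"
    and W: "\<And>i. i < n \<Longrightarrow> \<exists>F. planner Y (W i) F"
  shows "TC Y \<le> enat n"
  unfolding TC_def secat_def
proof (rule INF_lower, rule CollectI, rule exI[of _ W], intro conjI allI impI)
  let ?Q = "prod_topology Y Y"
  fix i assume i: "i < n"
  then obtain F where F: "planner Y (W i) F" using W by blast
  then show "openin ?Q (W i)" by (simp add: planner_def)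
  let ?s = "\<lambda>w. restrict (\<lambda>t. F (w, t)) {0..1}"
  have "continuous_map (subtopology ?Q (W i)) (path_space Y) ?s"
    using F by (intro continuous_map_into_path_space) (simp add: planner_def)
  moreover have "homotopic_with (\<lambda>_. True) (subtopology ?Q (W i)) ?Q id ((\<lambda>\<gamma>. (\<gamma> 0, \<gamma> 1)) \<circ> ?s)"
    using F by (intro homotopic_with_equal continuous_map_from_subtopology continuous_map_id) (auto simp: planner_def)
  ultimately show "\<exists>s. continuous_map (subtopology ?Q (W i)) (path_space Y) s \<and>
      homotopic_with (\<lambda>_. True) (subtopology ?Q (W i)) ?Q ((\<lambda>\<gamma>. (\<gamma> 0, \<gamma> 1)) \<circ> s) id"
    using homotopic_with_sym by blast
qed (use cov in auto)

section \<open>The associated bundle\<close>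

text \<open>\<open>XG\<close> is any quotient of \<open>E \<times> X\<close> by the orbits of the
  action sending \<open>(e, x)\<close> to \<open>(e g, inv g x)\<close>; this determines it up to
  homeomorphism without realising it as a set of classes.\<close>

locale associated_bundle =
  fixes G :: "('g, 'm) monoid_scheme" and TG :: "'g topology"
    and X :: "'x topology" and act :: "'g \<Rightarrow> 'x \<Rightarrow> 'x"
    and E :: "'e topology" and ract :: "'e \<Rightarrow> 'g \<Rightarrow> 'e"
    and B :: "'b topology" and p :: "'e \<Rightarrow> 'b"
    and XG :: "'c topology" and q :: "'e \<times> 'x \<Rightarrow> 'c"
  assumes TG: "topological_group G TG"
    and X: "left_G_space G TG act X"
    and principal: "numerable_principal_bundle G TG ract E B p"
    and q_quotient: "quotient_map (prod_topology E X) XG q"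
    and q_eq: "\<And>e x e' x'. e \<in> topspace E \<Longrightarrow> x \<in> topspace X \<Longrightarrow> e' \<in> topspace E \<Longrightarrow> x' \<in> topspace X \<Longrightarrow>
           q (e, x) = q (e', x') \<longleftrightarrow> (\<exists>g\<in>carrier G. e' = ract e g \<and> x' = act (inv\<^bsub>G\<^esub> g) x)"
begin

sublocale group G
  using TG by (simp add: topological_group_def)

lemma topspace_TG: "topspace TG = carrier G"
  using TG by (simp add: topological_group_def)

lemma continuous_act: "continuous_map (prod_topology TG X) X (\<lambda>(g, x). act g x)"
  using X by (simp add: left_G_space_def)

lemma act_closed: "g \<in> carrier G \<Longrightarrow> x \<in> topspace X \<Longrightarrow> act g x \<in> topspace X"
  using subsetD[OF continuous_map_image_subset_topspace[OF continuous_act] imageI[of "(g, x)"]]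
  by (simp add: topspace_TG)

lemma act_mult: "g \<in> carrier G \<Longrightarrow> h \<in> carrier G \<Longrightarrow> x \<in> topspace X \<Longrightarrow> act (g \<otimes>\<^bsub>G\<^esub> h) x = act g (act h x)"
  and act_one: "x \<in> topspace X \<Longrightarrow> act \<one>\<^bsub>G\<^esub> x = x"
  using X by (simp_all add: left_G_space_def)

lemma act_inv_act: "g \<in> carrier G \<Longrightarrow> x \<in> topspace X \<Longrightarrow> act (inv\<^bsub>G\<^esub> g) (act g x) = x"
  using act_mult[of "inv\<^bsub>G\<^esub> g" g x] by (simp add: act_one)

lemma continuous_ract: "continuous_map (prod_topology E TG) E (\<lambda>(e, g). ract e g)"
  using principal by (simp add: numerable_principal_bundle_def right_G_space_def)

lemmas ract_closed = principal_bundle_action(1)[OF principal topspace_TG]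
lemmas p_ract = principal_bundle_action(2)[OF principal topspace_TG]

lemma ract_mult:
  "g \<in> carrier G \<Longrightarrow> h \<in> carrier G \<Longrightarrow> e \<in> topspace E \<Longrightarrow> ract e (g \<otimes>\<^bsub>G\<^esub> h) = ract (ract e g) h"
  using principal by (simp add: numerable_principal_bundle_def right_G_space_def)

lemma continuous_p: "continuous_map E B p"
  using principal quotient_imp_continuous_map by (auto simp: numerable_principal_bundle_def)

lemma p_closed: "e \<in> topspace E \<Longrightarrow> p e \<in> topspace B"
  using continuous_map_image_subset_topspace[OF continuous_p] by blast

lemma q_image: "q ` (topspace E \<times> topspace X) = topspace XG"
  using quotient_imp_surjective_map[OF q_quotient] by simp

lemma q_ract: "e \<in> topspace E \<Longrightarrow> x \<in> topspace X \<Longrightarrow> g \<in> carrier G \<Longrightarrow> q (ract e g, act (inv\<^bsub>G\<^esub> g) x) = q (e, x)"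
  using q_eq[of e x "ract e g" "act (inv\<^bsub>G\<^esub> g) x"] by (auto simp: ract_closed act_closed)

text \<open>The saturation of an open set is the union of its preimages under the single group
  elements, each of which acts on \<open>E \<times> X\<close> by a continuous map.\<close>

lemma open_map_q: "open_map (prod_topology E X) XG q"
  unfolding open_map_def
proof (intro allI impI)
  fix O' assume O': "openin (prod_topology E X) O'"
  have sub: "O' \<subseteq> topspace E \<times> topspace X" using openin_subset[OF O'] by simp
  let ?P = "\<lambda>g. {z \<in> topspace (prod_topology E X). (ract (fst z) g, act (inv\<^bsub>G\<^esub> g) (snd z)) \<in> O'}"
  have "openin (prod_topology E X) (?P g)" if g: "g \<in> carrier G" for g
  proof (rule openin_continuous_map_preimage[OF _ O'])
    show "continuous_map (prod_topology E X) (prod_topology E X) (\<lambda>z. (ract (fst z) g, act (inv\<^bsub>G\<^esub> g) (snd z)))"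
      by (intro continuous_map_pairedI continuous_map_compose2[OF continuous_ract] continuous_map_compose2[OF continuous_act]
          continuous_map_fst continuous_map_snd) (use g in \<open>simp_all add: topspace_TG\<close>)
  qed
  then have "openin (prod_topology E X) (\<Union>g\<in>carrier G. ?P g)" by blast
  moreover have "{z \<in> topspace (prod_topology E X). q z \<in> q ` O'} = (\<Union>g\<in>carrier G. ?P g)"
  proof (intro Set.set_eqI iffI)
    fix z assume z: "z \<in> {z \<in> topspace (prod_topology E X). q z \<in> q ` O'}"
    then obtain e x e' x' where ex: "z = (e, x)" "e \<in> topspace E" "x \<in> topspace X" "(e', x') \<in> O'" "q (e, x) = q (e', x')"
      by auto
    then show "z \<in> (\<Union>g\<in>carrier G. ?P g)" using sub q_eq[of e x e' x'] by auto
  next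
    fix z assume "z \<in> (\<Union>g\<in>carrier G. ?P g)"
    then obtain g e x where g: "g \<in> carrier G" and z: "z = (e, x)" "e \<in> topspace E" "x \<in> topspace X"
      "(ract e g, act (inv\<^bsub>G\<^esub> g) x) \<in> O'" by auto
    then have "q z = q (ract e g, act (inv\<^bsub>G\<^esub> g) x)" using q_ract by simp
    then show "z \<in> {z \<in> topspace (prod_topology E X). q z \<in> q ` O'}" using z by auto
  qed
  moreover have "q ` O' \<subseteq> topspace XG" using sub q_image by blast
  ultimately show "openin XG (q ` O')" using q_quotient unfolding quotient_map_def by metis
qed

section \<open>Planners on the associated bundle from planners on base and fibre\<close>

abbreviation "P2 \<equiv> prod_topology (prod_topology E X) (prod_topology E X)"
abbreviation "q2 \<equiv> \<lambda>z. (q (fst z), q (snd z))"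

text \<open>Taken as an image because \<open>\<omega>\<close> does not descend to pairs of points of
  \<open>XG\<close>: a change of representatives alters it by the diagonal action. Membership in an
  invariant \<open>U\<close> does descend, and openness of \<open>q\<close> will make the image
  open.\<close>

definition cell :: "('b \<times> 'b) set \<Rightarrow> (('e \<times> 'x) \<times> ('e \<times> 'x) \<Rightarrow> 'x \<times> 'x) \<Rightarrow> ('x \<times> 'x) set \<Rightarrow> ('c \<times> 'c) set" where
  "cell V \<omega> U = q2 ` {z \<in> topspace P2. (p (fst (fst z)), p (fst (snd z))) \<in> V \<and> \<omega> z \<in> U}"

text \<open>The function \<open>\<omega>\<close> sends \<open>((e, x), (e', x'))\<close> to \<open>(x, g x')\<close>, where \<open>e' = e'' g\<close> and \<open>e''\<close> is the
  end point of the lift, starting at \<open>e\<close>, of the planned path from \<open>p e\<close> to \<open>p e'\<close>.\<close>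

lemma combined_planner:
  assumes V: "planner B V FV"
  obtains \<omega> where
    "\<And>z. z \<in> topspace P2 \<Longrightarrow> (p (fst (fst z)), p (fst (snd z))) \<in> V \<Longrightarrow> \<omega> z \<in> topspace (prod_topology X X)"
    "\<And>U FU. equivariant_planner G act X U FU \<Longrightarrow> \<exists>F. planner XG (cell V \<omega> U) F"
proof -
  have V: "openin (prod_topology B B) V"
    and FV: "continuous_map (prod_topology (subtopology (prod_topology B B) V) unit_I) B FV"
      "\<And>v. v \<in> V \<Longrightarrow> FV (v, 0) = fst v \<and> FV (v, 1) = snd v"
    using V by (auto simp: planner_def)
  let ?BV = "subtopology (prod_topology B B) V"
  have tBV: "topspace ?BV = V" using openin_subset[OF V] by auto
  obtain J :: "'b set set" and \<phi> \<tau> where lt: "local_transport E B p J \<phi> \<tau> ((\<lambda>g e. ract e g) ` carrier G)"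
    using principal_bundle_local_transport[OF TG principal] .
  obtain \<Lambda> where \<Lambda>_cont: "continuous_map (subtopology (prod_topology (prod_topology ?BV unit_I) E) {((w, t), e). p e = FV (w, 0)}) E
      (\<lambda>((w, t), e). \<Lambda> w t e)"
    and \<Lambda>: "\<And>w t e. w \<in> topspace ?BV \<Longrightarrow> t \<in> {0..1} \<Longrightarrow> e \<in> topspace E \<Longrightarrow> p e = FV (w, 0) \<Longrightarrow> p (\<Lambda> w t e) = FV (w, t)"
    "\<And>w e. w \<in> topspace ?BV \<Longrightarrow> e \<in> topspace E \<Longrightarrow> p e = FV (w, 0) \<Longrightarrow> \<Lambda> w 0 e = e"
    and \<Lambda>_equiv: "\<And>w t e \<sigma>. w \<in> topspace ?BV \<Longrightarrow> t \<in> {0..1} \<Longrightarrow> e \<in> topspace E \<Longrightarrow> p e = FV (w, 0) \<Longrightarrow>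
      \<sigma> \<in> (\<lambda>g e. ract e g) ` carrier G \<Longrightarrow> \<Lambda> w t (\<sigma> e) = \<sigma> (\<Lambda> w t e)"
    by (rule local_transport.covering_homotopy[OF lt FV(1)]) (rule that)
  note \<Lambda> = \<Lambda>[unfolded tBV] and \<Lambda>_equiv = \<Lambda>_equiv[unfolded tBV]
  obtain d where d_cont: "continuous_map (subtopology (prod_topology E E) {(e, e'). p e = p e'}) TG (\<lambda>(e, e'). d e e')"
    and d: "\<And>e e'. e \<in> topspace E \<Longrightarrow> e' \<in> topspace E \<Longrightarrow> p e = p e' \<Longrightarrow> d e e' \<in> carrier G \<and> ract e (d e e') = e'"
    and d_ract: "\<And>e g. e \<in> topspace E \<Longrightarrow> g \<in> carrier G \<Longrightarrow> d e (ract e g) = g"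
    by (rule principal_bundle_difference[OF TG principal]) (rule that)
  define v where "v z = (p (fst (fst z)), p (fst (snd z)))" for z :: "('e \<times> 'x) \<times> ('e \<times> 'x)"
  define lft where "lft z t = \<Lambda> (v z) t (fst (fst z))" for z t
  define \<omega> where "\<omega> z = (snd (fst z), act (d (lft z 1) (fst (snd z))) (snd (snd z)))" for z
  define Y where "Y = subtopology P2 {z. v z \<in> V}"
  have Yin: "z \<in> topspace Y \<longleftrightarrow> fst (fst z) \<in> topspace E \<and> snd (fst z) \<in> topspace X \<and>
      fst (snd z) \<in> topspace E \<and> snd (snd z) \<in> topspace X \<and> v z \<in> V" for z
    by (auto simp: Y_def mem_Times_iff)
  have cf: "continuous_map P2 E (\<lambda>z. fst (fst z))" "continuous_map P2 X (\<lambda>z. snd (fst z))"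
    "continuous_map P2 E (\<lambda>z. fst (snd z))" "continuous_map P2 X (\<lambda>z. snd (snd z))"
    by (auto intro: continuous_map_compose[unfolded o_def] continuous_map_fst continuous_map_snd)
  note cY = cf[THEN continuous_map_from_subtopology, of "{z. v z \<in> V}", folded Y_def]
  have cv: "continuous_map P2 (prod_topology B B) v"
    unfolding v_def by (intro continuous_map_pairedI continuous_map_compose[OF cf(1) continuous_p, unfolded o_def]
        continuous_map_compose[OF cf(3) continuous_p, unfolded o_def])
  have cvY: "continuous_map Y ?BV v"
    unfolding Y_def by (rule continuous_map_into_subtopology[OF continuous_map_from_subtopology[OF cv]]) auto
  have Yopen: "openin P2 {z \<in> topspace P2. v z \<in> V}" by (rule openin_continuous_map_preimage[OF cv V])
  have FV0: "p (fst (fst z)) = FV (v z, 0)" "FV (v z, 1) = p (fst (snd z))" if "z \<in> topspace Y" for z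
    using that FV(2)[of "v z"] Yin by (auto simp: v_def)
  have clft: "continuous_map (prod_topology Y unit_I) E (\<lambda>(z, t). lft z t)"
  proof -
    have "continuous_map (prod_topology Y unit_I) (prod_topology (prod_topology ?BV unit_I) E)
        (\<lambda>y. ((v (fst y), snd y), fst (fst (fst y))))"
      by (intro continuous_map_pairedI continuous_map_snd continuous_map_compose[OF continuous_map_fst cvY, unfolded o_def]
          continuous_map_compose[OF continuous_map_fst cY(1), unfolded o_def])
    then have "continuous_map (prod_topology Y unit_I)
        (subtopology (prod_topology (prod_topology ?BV unit_I) E) {((w, t), e). p e = FV (w, 0)})
        (\<lambda>y. ((v (fst y), snd y), fst (fst (fst y))))"
      using FV0(1) by (intro continuous_map_into_subtopology) auto
    from continuous_map_compose[OF this \<Lambda>_cont] show ?thesis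
      by (simp add: lft_def o_def case_prod_unfold)
  qed
  have lft_E: "lft z t \<in> topspace E" if "z \<in> topspace Y" "t \<in> {0..1}" for z t
    using subsetD[OF continuous_map_image_subset_topspace[OF clft] imageI[of "(z, t)"]] that by simp
  have lft_0: "lft z 0 = fst (fst z)" and lft_1: "p (lft z 1) = p (fst (snd z))" if "z \<in> topspace Y" for z
    using that \<Lambda>(2)[of "v z" "fst (fst z)"] \<Lambda>(1)[of "v z" 1 "fst (fst z)"] FV0[OF that] Yin by (auto simp: lft_def)
  have dz: "d (lft z 1) (fst (snd z)) \<in> carrier G" "ract (lft z 1) (d (lft z 1) (fst (snd z))) = fst (snd z)"
    if "z \<in> topspace Y" for z
    using d[of "lft z 1" "fst (snd z)"] lft_E[OF that, of 1] lft_1[OF that] that Yin by auto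
  have clft1: "continuous_map Y E (\<lambda>z. lft z 1)"
    by (rule continuous_map_compose2[OF clft]) auto
  have cd: "continuous_map Y TG (\<lambda>z. d (lft z 1) (fst (snd z)))"
  proof -
    have "continuous_map Y (subtopology (prod_topology E E) {(e, e'). p e = p e'}) (\<lambda>z. (lft z 1, fst (snd z)))"
      by (intro continuous_map_into_subtopology continuous_map_pairedI clft1 cY(3)) (use lft_1 in auto)
    from continuous_map_compose[OF this d_cont] show ?thesis by (simp add: o_def)
  qed
  have c\<omega>: "continuous_map Y (prod_topology X X) \<omega>"
    unfolding \<omega>_def by (intro continuous_map_pairedI cY(2) continuous_map_compose2[OF continuous_act cd cY(4)])
  have \<omega>X: "\<omega> z \<in> topspace (prod_topology X X)" if "z \<in> topspace Y" for z
    using continuous_map_image_subset_topspace[OF c\<omega>] that by blast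
  \<comment> \<open>Let \<open>h\<close> and \<open>k\<close> relate the representatives of the
    first and of the second point. The new lift starts at \<open>e h\<close>, so it is the old one
    translated by \<open>h\<close>. The group element \<open>g\<close> becomes
    \<open>inv h g k\<close>, and \<open>k\<close> cancels against \<open>y' = inv k y\<close>, so
    only the diagonal action of \<open>inv h\<close> remains.\<close>
  have change: "\<exists>h\<in>carrier G. (\<forall>t\<in>{0..1}. lft z' t = ract (lft z t) h) \<and>
      \<omega> z' = (act (inv\<^bsub>G\<^esub> h) (fst (\<omega> z)), act (inv\<^bsub>G\<^esub> h) (snd (\<omega> z)))"
    if z: "z \<in> topspace Y" and z': "z' \<in> topspace Y" and eq: "q2 z = q2 z'" for z z'
  proof -
    obtain e x f y where ez: "z = ((e, x), (f, y))" by (metis surj_pair)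
    obtain e' x' f' y' where ez': "z' = ((e', x'), (f', y'))" by (metis surj_pair)
    have E: "e \<in> topspace E" "x \<in> topspace X" "f \<in> topspace E" "y \<in> topspace X"
      and E': "e' \<in> topspace E" "x' \<in> topspace X" "f' \<in> topspace E" "y' \<in> topspace X"
      using z z' Yin ez ez' by auto
    obtain h where h: "h \<in> carrier G" "e' = ract e h" "x' = act (inv\<^bsub>G\<^esub> h) x"
      using eq q_eq[OF E(1,2) E'(1,2)] ez ez' by auto
    obtain k where k: "k \<in> carrier G" "f' = ract f k" "y' = act (inv\<^bsub>G\<^esub> k) y"
      using eq q_eq[OF E(3,4) E'(3,4)] ez ez' by auto
    have vz: "v z' = v z" by (simp add: v_def ez ez' h(2) k(2) p_ract E h(1) k(1))
    have 1: "lft z' t = ract (lft z t) h" if "t \<in> {0..1}" for t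
      using \<Lambda>_equiv[of "v z" t e "\<lambda>e. ract e h"] that z E(1) h(1) FV0(1)[OF z] Yin
      unfolding lft_def vz by (simp add: ez ez' h(2))
    define g where "g = d (lft z 1) f"
    have g: "g \<in> carrier G" "ract (lft z 1) g = f" using dz[OF z] by (simp_all add: g_def ez)
    have l: "lft z 1 \<in> topspace E" using lft_E[OF z] by simp
    have "f' = ract (ract (lft z 1) h) (inv\<^bsub>G\<^esub> h \<otimes>\<^bsub>G\<^esub> (g \<otimes>\<^bsub>G\<^esub> k))"
    proof -
      have "ract (ract (lft z 1) h) (inv\<^bsub>G\<^esub> h \<otimes>\<^bsub>G\<^esub> (g \<otimes>\<^bsub>G\<^esub> k)) =
          ract (lft z 1) (h \<otimes>\<^bsub>G\<^esub> (inv\<^bsub>G\<^esub> h \<otimes>\<^bsub>G\<^esub> (g \<otimes>\<^bsub>G\<^esub> k)))"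
        using h(1) k(1) g(1) l by (intro ract_mult[symmetric]) auto
      also have "h \<otimes>\<^bsub>G\<^esub> (inv\<^bsub>G\<^esub> h \<otimes>\<^bsub>G\<^esub> (g \<otimes>\<^bsub>G\<^esub> k)) = g \<otimes>\<^bsub>G\<^esub> k"
        using h(1) k(1) g(1) by (simp add: m_assoc[symmetric])
      also have "ract (lft z 1) (g \<otimes>\<^bsub>G\<^esub> k) = f'" using g k l by (simp add: ract_mult)
      finally show ?thesis by simp
    qed
    then have "d (lft z' 1) f' = inv\<^bsub>G\<^esub> h \<otimes>\<^bsub>G\<^esub> (g \<otimes>\<^bsub>G\<^esub> k)"
      using 1[of 1] d_ract[OF ract_closed[OF l h(1)], of "inv\<^bsub>G\<^esub> h \<otimes>\<^bsub>G\<^esub> (g \<otimes>\<^bsub>G\<^esub> k)"] h(1) k(1) g(1) by simp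
    then have "act (d (lft z' 1) f') y' = act (inv\<^bsub>G\<^esub> h \<otimes>\<^bsub>G\<^esub> (g \<otimes>\<^bsub>G\<^esub> k)) (act (inv\<^bsub>G\<^esub> k) y)"
      by (simp add: k(3))
    also have "\<dots> = act (inv\<^bsub>G\<^esub> h) (act g (act k (act (inv\<^bsub>G\<^esub> k) y)))"
      using h(1) k(1) g(1) E(4) by (simp add: act_mult act_closed)
    also have "act k (act (inv\<^bsub>G\<^esub> k) y) = y"
      using act_mult[of k "inv\<^bsub>G\<^esub> k" y] k(1) E(4) by (simp add: act_one)
    finally have 2: "act (d (lft z' 1) f') y' = act (inv\<^bsub>G\<^esub> h) (act g y)" .
    have "\<omega> z' = (act (inv\<^bsub>G\<^esub> h) (fst (\<omega> z)), act (inv\<^bsub>G\<^esub> h) (snd (\<omega> z)))"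
      using 2 by (simp add: \<omega>_def ez ez' h(3) g_def)
    then show ?thesis using h(1) 1 by blast
  qed
  show thesis
  proof (rule that[of \<omega>])
    show "\<omega> z \<in> topspace (prod_topology X X)" if "z \<in> topspace P2" "(p (fst (fst z)), p (fst (snd z))) \<in> V" for z
      using that by (intro \<omega>X) (auto simp: Y_def v_def)
  next
    fix U FU assume planner_U: "equivariant_planner G act X U FU"
    then have U: "openin (prod_topology X X) U"
      and FU: "continuous_map (prod_topology (subtopology (prod_topology X X) U) unit_I) X FU"
      and FU_ends: "\<And>u. u \<in> U \<Longrightarrow> FU (u, 0) = fst u \<and> FU (u, 1) = snd u"
      unfolding equivariant_planner_def planner_def by blast+
    have FU_equiv: "FU ((act g a, act g b), t) = act g (FU ((a, b), t))"
      if "g \<in> carrier G" "(a, b) \<in> U" "t \<in> {0..1}" for g a b t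
      using planner_U that unfolding equivariant_planner_def by blast
    define N where "N = {z \<in> topspace P2. (p (fst (fst z)), p (fst (snd z))) \<in> V \<and> \<omega> z \<in> U}"
    define W where "W = q2 ` N"
    have N: "z \<in> N \<longleftrightarrow> z \<in> topspace Y \<and> \<omega> z \<in> U" for z by (auto simp: N_def Y_def v_def)
    have Nopen: "openin P2 N"
    proof -
      have eqY: "Y = subtopology P2 {z \<in> topspace P2. v z \<in> V}"
        unfolding Y_def using subtopology_restrict[of P2 "{z. v z \<in> V}"] by (simp add: Collect_conj_eq)
      have "{z \<in> topspace Y. \<omega> z \<in> U} = N" using N by blast
      moreover have "openin Y {z \<in> topspace Y. \<omega> z \<in> U}" by (rule openin_continuous_map_preimage[OF c\<omega> U])
      ultimately have "openin (subtopology P2 {z \<in> topspace P2. v z \<in> V}) N"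
        unfolding eqY[symmetric] by simp
      then show ?thesis by (rule openin_trans_full[OF _ Yopen])
    qed
    have q2_open: "open_map P2 (prod_topology XG XG) q2" by (rule open_map_prod[OF open_map_q open_map_q])
    have q_cont: "continuous_map (prod_topology E X) XG q" by (rule quotient_imp_continuous_map[OF q_quotient])
    have q2_cont: "continuous_map P2 (prod_topology XG XG) q2"
      by (intro continuous_map_pairedI continuous_map_compose[OF continuous_map_fst q_cont, unfolded o_def]
          continuous_map_compose[OF continuous_map_snd q_cont, unfolded o_def])
    have Wopen: "openin (prod_topology XG XG) W"
      using q2_open Nopen unfolding open_map_def W_def by blast
    let ?PN = "subtopology P2 N" and ?QW = "subtopology (prod_topology XG XG) W"
    have tN: "topspace ?PN = N" using openin_subset[OF Nopen] by auto
    have tW: "topspace ?QW = W" using openin_subset[OF Wopen] by auto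
    \<comment> \<open>\<open>q2\<close> stays open when restricted to the open set \<open>N\<close>
      and multiplied with the interval, so continuity of a map on \<open>W\<close> and the interval
      can be tested on representatives.\<close>
    have quot: "quotient_map (prod_topology ?PN unit_I) (prod_topology ?QW unit_I) (\<lambda>y. (q2 (fst y), id (snd y)))"
    proof (rule continuous_open_imp_quotient_map)
      have c: "continuous_map ?PN ?QW q2"
        by (rule continuous_map_into_subtopology[OF continuous_map_from_subtopology[OF q2_cont]]) (auto simp: W_def tN)
      show "continuous_map (prod_topology ?PN unit_I) (prod_topology ?QW unit_I) (\<lambda>y. (q2 (fst y), id (snd y)))"
        by (intro continuous_map_pairedI continuous_map_compose[OF continuous_map_fst c, unfolded o_def])
          (simp add: continuous_map_snd)
      have "open_map ?PN ?QW q2"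
        unfolding open_map_def
      proof (intro allI impI)
        fix O' assume O': "openin ?PN O'"
        then have O'2: "openin P2 O'" "O' \<subseteq> N" by (simp_all add: openin_open_subtopology[OF Nopen])
        then have "openin (prod_topology XG XG) (q2 ` O')" using q2_open unfolding open_map_def by blast
        moreover have "q2 ` O' \<subseteq> W" using O'2(2) unfolding W_def by blast
        ultimately show "openin ?QW (q2 ` O')" by (simp add: openin_open_subtopology[OF Wopen])
      qed
      then show "open_map (prod_topology ?PN unit_I) (prod_topology ?QW unit_I) (\<lambda>y. (q2 (fst y), id (snd y)))"
        by (rule open_map_prod) (simp add: open_map_def)
      show "(\<lambda>y. (q2 (fst y), id (snd y))) ` topspace (prod_topology ?PN unit_I) = topspace (prod_topology ?QW unit_I)"
      proof -
        have "(\<lambda>y. (q2 (fst y), id (snd y))) ` (N \<times> {0..1}) = W \<times> {0..1}"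
          unfolding W_def by (auto intro!: image_eqI)
        then show ?thesis by (simp only: topspace_prod_topology tN tW topspace_euclidean_subtopology)
      qed
    qed
    define \<Phi>' where "\<Phi>' z t = q (lft z t, FU (\<omega> z, t))" for z t
    have FUX: "FU (\<omega> z, t) \<in> topspace X" if "z \<in> N" "t \<in> {0..1}" for z t
      using subsetD[OF continuous_map_image_subset_topspace[OF FU] imageI[of "(\<omega> z, t)"]] that openin_subset[OF U] N by auto
    have \<Phi>'_cont: "continuous_map (prod_topology ?PN unit_I) XG (\<lambda>y. \<Phi>' (fst y) (snd y))"
    proof -
      have eq: "?PN = subtopology Y N"
      proof -
        have "{z. v z \<in> V} \<inter> N = N" using N Yin by blast
        then show ?thesis unfolding Y_def by (simp add: subtopology_subtopology)
      qed
      have 1: "continuous_map (prod_topology ?PN unit_I) E (\<lambda>y. lft (fst y) (snd y))"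
        unfolding eq prod_topology_subtopology(1)
        using continuous_map_from_subtopology[OF clft] by (simp add: case_prod_unfold)
      have "continuous_map ?PN (subtopology (prod_topology X X) U) \<omega>"
        unfolding eq
        by (rule continuous_map_into_subtopology[OF continuous_map_from_subtopology[OF c\<omega>]]) (use N in auto)
      from continuous_map_compose[OF continuous_map_pairedI[OF continuous_map_compose[OF continuous_map_fst this] continuous_map_snd] FU]
      have 2: "continuous_map (prod_topology ?PN unit_I) X (\<lambda>y. FU (\<omega> (fst y), snd y))" by (simp add: o_def)
      show ?thesis
        unfolding \<Phi>'_def using continuous_map_compose[OF continuous_map_pairedI[OF 1 2] q_cont] by (simp add: o_def)
    qed
    have \<Phi>'_eq: "\<Phi>' z' t = \<Phi>' z t" if z: "z \<in> N" and z': "z' \<in> N" and eq: "q2 z = q2 z'" and t: "t \<in> {0..1}" for z z' t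
    proof -
      have zY: "z \<in> topspace Y" "z' \<in> topspace Y" and zU: "\<omega> z \<in> U" using z z' N by auto
      obtain h where h: "h \<in> carrier G" "lft z' t = ract (lft z t) h"
        "\<omega> z' = (act (inv\<^bsub>G\<^esub> h) (fst (\<omega> z)), act (inv\<^bsub>G\<^esub> h) (snd (\<omega> z)))"
        using change[OF zY eq] t by blast
      have "FU (\<omega> z', t) = act (inv\<^bsub>G\<^esub> h) (FU (\<omega> z, t))"
        unfolding h(3) using FU_equiv[of "inv\<^bsub>G\<^esub> h" "fst (\<omega> z)" "snd (\<omega> z)" t] h(1) zU t by simp
      then show ?thesis
        unfolding \<Phi>'_def h(2) using q_ract[OF lft_E[OF zY(1) t] FUX[OF z t] h(1)] by simp
    qed
    \<comment> \<open>No continuity is asked of this choice of representatives: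
      \<open>\<Phi>'\<close> does not depend on it, and continuity of the descended map comes from
      \<open>quot\<close>.\<close>
    define r where "r w = (SOME z. z \<in> N \<and> q2 z = w)" for w
    have r: "r w \<in> N \<and> q2 (r w) = w" if "w \<in> W" for w
    proof -
      have "\<exists>z. z \<in> N \<and> q2 z = w" using that unfolding W_def by blast
      then show ?thesis unfolding r_def by (rule someI_ex)
    qed
    have r_eq: "\<Phi>' (r (q2 z)) t = \<Phi>' z t" if z: "z \<in> N" and t: "t \<in> {0..1}" for z t
    proof -
      have "q2 z \<in> W" using z unfolding W_def by blast
      from r[OF this] show ?thesis using \<Phi>'_eq[OF z _ _ t] by metis
    qed
    have \<Phi>_cont: "continuous_map (prod_topology ?QW unit_I) XG (\<lambda>y. \<Phi>' (r (fst y)) (snd y))"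
    proof (rule continuous_compose_quotient_map[OF quot])
      show "continuous_map (prod_topology ?PN unit_I) XG ((\<lambda>y. \<Phi>' (r (fst y)) (snd y)) \<circ> (\<lambda>y. (q2 (fst y), id (snd y))))"
        by (rule continuous_map_eq[OF \<Phi>'_cont]) (use r_eq tN in auto)
    qed
    have ends: "(\<Phi>' z 0, \<Phi>' z 1) = q2 z" if z: "z \<in> N" for z
    proof -
      have zY: "z \<in> topspace Y" and zU: "\<omega> z \<in> U" using z N by auto
      have X: "snd (snd z) \<in> topspace X" using zY Yin by blast
      let ?g = "d (lft z 1) (fst (snd z))"
      have "\<Phi>' z 1 = q (lft z 1, act ?g (snd (snd z)))"
        using FU_ends[OF zU] by (simp add: \<Phi>'_def) (simp add: \<omega>_def)
      also have "\<dots> = q (ract (lft z 1) ?g, act (inv\<^bsub>G\<^esub> ?g) (act ?g (snd (snd z))))"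
        using q_ract[OF lft_E[OF zY, of 1] act_closed[OF dz(1)[OF zY] X] dz(1)[OF zY]] by simp
      also have "\<dots> = q (snd z)" using dz[OF zY] act_inv_act[OF dz(1)[OF zY] X] by simp
      finally have "\<Phi>' z 1 = q (snd z)" .
      moreover have "\<Phi>' z 0 = q (fst z)"
        using FU_ends[OF zU] lft_0[OF zY] by (simp add: \<Phi>'_def) (simp add: \<omega>_def)
      ultimately show ?thesis by simp
    qed
    have "planner XG W (\<lambda>y. \<Phi>' (r (fst y)) (snd y))"
      using Wopen \<Phi>_cont r ends by (auto simp: planner_def prod_eq_iff)
    then show "\<exists>F. planner XG (cell V \<omega> U) F"
      unfolding cell_def W_def N_def by blast
  qed
qed

end

section \<open>Counting the domains\<close>

theorem theorem5p16:
  fixes G :: "('g, 'm) monoid_scheme" and TG :: "'g topology"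
    and X :: "'x topology" and act :: "'g \<Rightarrow> 'x \<Rightarrow> 'x"
    and E :: "'e topology" and ract :: "'e \<Rightarrow> 'g \<Rightarrow> 'e"
    and B :: "'b topology" and p :: "'e \<Rightarrow> 'b"
    and XG :: "'c topology" and q :: "'e \<times> 'x \<Rightarrow> 'c"
  assumes "topological_group G TG" and "compact_space TG" and "Hausdorff_space TG"
    and "left_G_space G TG act X" and "Hausdorff_space X"
    and "numerable_principal_bundle G TG ract E B p"
    and "quotient_map (prod_topology E X) XG q"
    and "\<And>e x e' x'. e \<in> topspace E \<Longrightarrow> x \<in> topspace X \<Longrightarrow> e' \<in> topspace E \<Longrightarrow> x' \<in> topspace X \<Longrightarrow>
           q (e, x) = q (e', x') \<longleftrightarrow> (\<exists>g\<in>carrier G. e' = ract e g \<and> x' = act (inv\<^bsub>G\<^esub> g) x)"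
  shows "TC XG \<le> TC_G G act X * TC B"
proof -
  interpret associated_bundle G TG X act E ract B p XG q
    using assms(1,4,6,7,8) by (rule associated_bundle.intro)
  have empty: "TC XG \<le> 0" if "topspace E \<times> topspace X = {}"
  proof -
    have "topspace XG = {}" using q_image that by auto
    then have "TC XG \<le> enat 0" by (intro TC_le[where W = "\<lambda>_. {}"]) auto
    then show ?thesis by (simp add: zero_enat_def)
  qed
  show ?thesis
  \<comment> \<open>In \<open>enat\<close> the product of \<open>0\<close> and
    \<open>\<infinity>\<close> is \<open>0\<close>, so a zero factor is treated before an infinite
    one. It forces \<open>X\<close> or \<open>B\<close> to be empty, in the latter case also
    \<open>E\<close>, and then \<open>XG\<close> is covered by no sets at all.\<close>
  proof (cases "TC_G G act X = 0 \<or> TC B = 0")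
    case True
    have "topspace E \<times> topspace X = {}"
    proof (cases "TC_G G act X = 0")
      case True
      then have "TC_G G act X = enat 0" by (simp add: zero_enat_def)
      from TC_G_witness[OF this] have "topspace (prod_topology X X) = {}" by (metis SUP_empty lessThan_0 subset_empty)
      then show ?thesis by auto
    next
      case False
      then have "TC B = enat 0" using \<open>TC_G G act X = 0 \<or> TC B = 0\<close> by (simp add: zero_enat_def)
      from TC_witness[OF this] have "topspace (prod_topology B B) = {}" by (metis SUP_empty lessThan_0 subset_empty)
      then have "topspace B = {}" by auto
      then show ?thesis using p_closed by blast
    qed
    from order_trans[OF empty[OF this]] show ?thesis by simp
  next
    case nonzero: False
    show ?thesis
    proof (cases "TC_G G act X = \<infinity> \<or> TC B = \<infinity>")
      case True
      then have "TC_G G act X * TC B = \<infinity>" using nonzero by (auto simp: imult_is_infinity)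
      then show ?thesis by simp
    next
      case False
      then obtain k l where k: "TC_G G act X = enat k" and l: "TC B = enat l" by auto
      obtain U FU where U_cov: "topspace (prod_topology X X) \<subseteq> (\<Union>i<k. U i)"
        and U: "\<And>i. i < k \<Longrightarrow> equivariant_planner G act X (U i) (FU i)"
        by (rule TC_G_witness[OF k]) (rule that)
      obtain V FV where V_cov: "topspace (prod_topology B B) \<subseteq> (\<Union>j<l. V j)"
        and V: "\<And>j. j < l \<Longrightarrow> planner B (V j) (FV j)"
        by (rule TC_witness[OF l]) (rule that)
      have "\<forall>j. \<exists>\<omega>. j < l \<longrightarrow>
        (\<forall>z\<in>topspace P2. (p (fst (fst z)), p (fst (snd z))) \<in> V j \<longrightarrow> \<omega> z \<in> topspace (prod_topology X X)) \<and>
        (\<forall>i<k. \<exists>F. planner XG (cell (V j) \<omega> (U i)) F)"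
        using combined_planner[OF V] U by metis
      from choice[OF this] obtain \<omega> where \<omega>: "\<forall>j. j < l \<longrightarrow>
        (\<forall>z\<in>topspace P2. (p (fst (fst z)), p (fst (snd z))) \<in> V j \<longrightarrow> \<omega> j z \<in> topspace (prod_topology X X)) \<and>
        (\<forall>i<k. \<exists>F. planner XG (cell (V j) (\<omega> j) (U i)) F)" ..
      \<comment> \<open>Quotient and remainder by \<open>l\<close> encode an index for
        \<open>X\<close> and an index for \<open>B\<close> in one number below
        \<open>k * l\<close>.\<close>
      define W where "W n = cell (V (n mod l)) (\<omega> (n mod l)) (U (n div l))" for n
      have kl: "n mod l < l" "n div l < k" if "n < k * l" for n
      proof -
        have "0 < l" using that by (cases l) auto
        then show "n mod l < l" "n div l < k" using that by (auto simp: less_mult_imp_div_less)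
      qed
      have "TC XG \<le> enat (k * l)"
      proof (rule TC_le[where W = W])
        show "\<exists>F. planner XG (W n) F" if "n < k * l" for n
          using \<omega> kl[OF that] unfolding W_def by blast
        show "topspace (prod_topology XG XG) \<subseteq> (\<Union>n<k * l. W n)"
        proof
          fix w assume "w \<in> topspace (prod_topology XG XG)"
          then obtain e x e' x' where z: "e \<in> topspace E" "x \<in> topspace X" "e' \<in> topspace E" "x' \<in> topspace X"
            and w: "w = (q (e, x), q (e', x'))"
            unfolding topspace_prod_topology q_image[symmetric] by blast
          let ?z = "((e, x), (e', x'))"
          have zP: "?z \<in> topspace P2" using z by simp
          \<comment> \<open>The index for \<open>B\<close> comes first: the map
            \<open>\<omega> j\<close>, whose value selects the index for \<open>X\<close>, is built
            from the planner on \<open>V j\<close>.\<close>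
          obtain j where j: "j < l" "(p e, p e') \<in> V j" using V_cov p_closed z by fastforce
          have "\<omega> j ?z \<in> topspace (prod_topology X X)" using \<omega> j zP by simp
          then obtain i where i: "i < k" "\<omega> j ?z \<in> U i" using U_cov by blast
          let ?n = "i * l + j"
          have n: "?n mod l = j" "?n div l = i" using j(1) by auto
          have "?n < k * l"
          proof -
            have "?n < (i + 1) * l" using j(1) by simp
            also have "\<dots> \<le> k * l" using i(1) by (intro mult_right_mono) auto
            finally show ?thesis .
          qed
          moreover have "w \<in> W ?n"
            unfolding W_def n cell_def by (rule image_eqI[of _ _ ?z]) (use w zP i j in auto)
          ultimately show "w \<in> (\<Union>n<k * l. W n)" by blast
        qed
      qed
      then show ?thesis by (simp add: k l)
    qed
  qed
qed

end
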